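(* Let $G$ be a unicyclic graph containing an odd cycle, with vertex set $V$. Let $C_{2s+1}$ denote the unique odd cycle (of length $2s+1$, for $s\ge1$) in $G$ and let $I=I(G)$. For any $t\ge s+1$, we have $$\dim(I^{(t)}/I^t)=\dim(I^{(s+1)}/I^{s+1})=\alpha\big(G[V\setminus N[C_{2s+1}]]\big).$$
   Context: A graph on the vertex set $V=[n]=\{1,\dots,n\}$ always means a simple connected graph; it is unicyclic if it has a unique cycle. Its edge ideal is $I(G)=(x_ix_j:\{i,j\}\in E(G))\subseteq S=k[x_1,\dots,x_n]$, $k$ an arbitrary field. The $t$-th symbolic power is $I^{(t)}=\bigcap_{\mathfrak p\in\mathrm{Ass}(I)}(I^tS_{\mathfrak p}\cap S)$. For $F\subseteq V$, $N(F)$ is the set of vertices adjacent to at least one vertex of $F$ and $N[F]=N(F)\cup F$ (a cycle is identified with its vertex set). $G[W]$ is the induced subgraph on $W$ (not necessarily connected, possibly empty), and $\alpha(H)$ is the maximum size of an independent set of a graph $H$ (with $\alpha=0$ for the empty graph). By convention the zero module has dimension $-1$. *)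

theory Defs
  imports
    "HOL-Algebra.QuotRing"
    "HOL-Algebra.Ideal_Product"
    "HOL-Algebra.Module"
    "HOL-Algebra.Algebraic_Closure_Type"
    "HOL-Library.Poly_Mapping"
    "HOL-Library.Extended_Real"
begin

section \<open>Graphs\<close>

text \<open>The vertex set of the ambient graph is the whole of a finite type \<open>'v\<close>; the graph is given
  by its set of edges, each edge being a two-element set of vertices.\<close>

definition simple_graph :: "'v::finite set set \<Rightarrow> bool" where
  "simple_graph E \<longleftrightarrow> (\<forall>e\<in>E. card e = 2)"

definition connected_graph :: "'v::finite set set \<Rightarrow> bool" where
  "connected_graph E \<longleftrightarrow> (\<forall>u v. (u, v) \<in> {(a, b). {a, b} \<in> E}\<^sup>*)"

text \<open>A cycle is presented by the list of its successive vertices. Different lists (rotations,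
  reversals) present the same cycle of the graph, so cycles are counted through the edge sets of the
  corresponding subgraphs.\<close>

definition cycle_edges :: "'v list \<Rightarrow> 'v set set" where
  "cycle_edges c = {{c ! i, c ! (Suc i mod length c)} |i. i < length c}"

definition graph_cycle :: "'v set set \<Rightarrow> 'v list \<Rightarrow> bool" where
  "graph_cycle E c \<longleftrightarrow> 3 \<le> length c \<and> distinct c \<and> cycle_edges c \<subseteq> E"

definition unicyclic :: "'v set set \<Rightarrow> bool" where
  "unicyclic E \<longleftrightarrow> (\<exists>!C. \<exists>c. graph_cycle E c \<and> C = cycle_edges c)"

definition nbhd :: "'v set set \<Rightarrow> 'v set \<Rightarrow> 'v set" where
  "nbhd E F = {v. \<exists>u\<in>F. {u, v} \<in> E}"

definition closed_nbhd :: "'v set set \<Rightarrow> 'v set \<Rightarrow> 'v set" where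
  "closed_nbhd E F = nbhd E F \<union> F"

definition induced_edges :: "'v set set \<Rightarrow> 'v set \<Rightarrow> 'v set set" where
  "induced_edges E W = {e \<in> E. e \<subseteq> W}"

definition independence_number :: "'v set \<Rightarrow> 'v set set \<Rightarrow> nat" where
  "independence_number W F = Max (card ` {A. A \<subseteq> W \<and> (\<forall>a\<in>A. \<forall>b\<in>A. {a, b} \<notin> F)})"


section \<open>Krull dimension of rings and modules\<close>

text \<open>The dimension is the supremum of the lengths of strict chains of prime ideals. The value \<open>-1\<close>
  is attained exactly when there is no prime ideal, that is, for the zero ring; this gives the
  convention that the zero module has dimension \<open>-1\<close>.\<close>

definition krull_dim :: "('a, 'm) ring_scheme \<Rightarrow> ereal" where
  "krull_dim R = Sup (insert (- 1) {ereal (real n) |n.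
      \<exists>P. (\<forall>i\<le>n. primeideal (P i) R) \<and> (\<forall>i<n. P i \<subset> P (Suc i))})"

definition annihilator :: "('a, 'm) ring_scheme \<Rightarrow> ('a, 'b, 'n) module_scheme \<Rightarrow> 'a set" where
  "annihilator R M = {r \<in> carrier R. \<forall>x\<in>carrier M. r \<odot>\<^bsub>M\<^esub> x = \<zero>\<^bsub>M\<^esub>}"

definition module_dim :: "('a, 'm) ring_scheme \<Rightarrow> ('a, 'b, 'n) module_scheme \<Rightarrow> ereal" where
  "module_dim R M = krull_dim (R Quot annihilator R M)"

text \<open>The \<open>R\<close>-module \<open>A / B\<close> for ideals \<open>B \<subseteq> A\<close> of \<open>R\<close>. The fields \<open>mult\<close> and \<open>one\<close> of the
  record play no role for modules.\<close>

definition quotient_module :: "('a, 'm) ring_scheme \<Rightarrow> 'a set \<Rightarrow> 'a set \<Rightarrow> ('a, 'a set) module" where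
  "quotient_module R A B =
    \<lparr>carrier = (\<lambda>a. B +>\<^bsub>R\<^esub> a) ` A, monoid.mult = undefined, one = undefined,
     ring.zero = B, add = set_add R,
     module.smult = (\<lambda>r Y. \<Union>x\<in>Y. B +>\<^bsub>R\<^esub> (r \<otimes>\<^bsub>R\<^esub> x))\<rparr>"


section \<open>Symbolic powers\<close>

definition associated_primes ::
  "('a, 'm) ring_scheme \<Rightarrow> ('a, 'b, 'n) module_scheme \<Rightarrow> 'a set set" where
  "associated_primes R M =
    {P. primeideal P R \<and> (\<exists>x\<in>carrier M. P = {r \<in> carrier R. r \<odot>\<^bsub>M\<^esub> x = \<zero>\<^bsub>M\<^esub>})}"

text \<open>The fraction \<open>a / s\<close> as an element of the localization of \<open>R\<close> at the prime \<open>P\<close>, i.e. the class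
  of the pair \<open>(a, s)\<close>.\<close>

definition loc_frac :: "('a, 'm) ring_scheme \<Rightarrow> 'a set \<Rightarrow> 'a \<Rightarrow> 'a \<Rightarrow> ('a \<times> 'a) set" where
  "loc_frac R P a s = {(b, u). b \<in> carrier R \<and> u \<in> carrier R - P \<and>
      (\<exists>w\<in>carrier R - P. w \<otimes>\<^bsub>R\<^esub> (a \<otimes>\<^bsub>R\<^esub> u) = w \<otimes>\<^bsub>R\<^esub> (b \<otimes>\<^bsub>R\<^esub> s))}"

text \<open>The extension of the ideal \<open>J\<close> to the localization at \<open>P\<close>, and the contraction of a subset \<open>L\<close>
  of the localization along the canonical map \<open>f \<mapsto> f / 1\<close>.\<close>

definition loc_extension :: "('a, 'm) ring_scheme \<Rightarrow> 'a set \<Rightarrow> 'a set \<Rightarrow> ('a \<times> 'a) set set" where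
  "loc_extension R P J = {loc_frac R P a s |a s. a \<in> J \<and> s \<in> carrier R - P}"

definition loc_contraction :: "('a, 'm) ring_scheme \<Rightarrow> 'a set \<Rightarrow> ('a \<times> 'a) set set \<Rightarrow> 'a set" where
  "loc_contraction R P L = {f \<in> carrier R. loc_frac R P f \<one>\<^bsub>R\<^esub> \<in> L}"

definition ideal_power :: "('a, 'm) ring_scheme \<Rightarrow> 'a set \<Rightarrow> nat \<Rightarrow> 'a set" where
  "ideal_power R I t = I [^]\<^bsub>ideals_set R\<^esub> t"

text \<open>\<open>Ass(I)\<close> denotes the associated primes of the module \<open>R / I\<close>.\<close>

definition symbolic_power :: "('a, 'm) ring_scheme \<Rightarrow> 'a set \<Rightarrow> nat \<Rightarrow> 'a set" where
  "symbolic_power R I t = carrier R \<inter>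
    (\<Inter>P\<in>associated_primes R (quotient_module R (carrier R) I).
        loc_contraction R P (loc_extension R P (ideal_power R I t)))"


section \<open>Edge ideals\<close>

text \<open>Monomials are finitely supported exponent functions, and polynomials are finitely supported
  functions from monomials to coefficients.\<close>

type_synonym ('v, 'k) mpolynomial = "('v \<Rightarrow>\<^sub>0 nat) \<Rightarrow>\<^sub>0 'k"

abbreviation mpoly_ring :: "('v::finite, 'k::field) mpolynomial ring" where
  "mpoly_ring \<equiv> ring_of_type_algebra"

definition var :: "'v::finite \<Rightarrow> ('v, 'k::field) mpolynomial" where
  "var v = Poly_Mapping.single (Poly_Mapping.single v 1) 1"

definition edge_ideal :: "'v::finite set set \<Rightarrow> ('v, 'k::field) mpolynomial set" where
  "edge_ideal E = Idl\<^bsub>mpoly_ring\<^esub> {var i * var j |i j. {i, j} \<in> E}"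

end

theory Submission
  imports Defs
begin

text \<open>All the ideals involved are generated by monomials, so they are described by exponent vectors.
  The power \<open>I^t\<close> consists of the polynomials all of whose exponents dominate a sum of \<open>t\<close> edges,
  and the symbolic power \<open>I^(t)\<close> of those all of whose exponents have weight at least \<open>t\<close> on every
  vertex cover (\<open>symbolic_power_edge_ideal\<close>), because the associated primes of \<open>I\<close> are generated by
  the vertex covers in which no vertex is superfluous. The dimension in question is the Krull
  dimension of the polynomial ring modulo the annihilator \<open>J\<close> of \<open>I^(t) / I^t\<close>. Let \<open>C\<close> be the vertex
  set of the cycle and let \<open>W\<close> be the complement of \<open>N[C]\<close>.

  Upper bound. The ideal \<open>J\<close> contains \<open>(x_u x_v)^t\<close> for every edge \<open>{u, v}\<close>, and it contains \<open>x_u^t\<close> for every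
  \<open>u\<close> in \<open>N[C]\<close> (\<open>power_near_cycle\<close>). For the latter, let \<open>w\<close> be a neighbour of \<open>u\<close> on the cycle.
  Deleting \<open>w\<close> leaves a forest, and in a forest the least weight of a vertex cover is the greatest
  number of edges that can be packed into an exponent vector (\<open>forest_matching\<close>); the weight of \<open>w\<close>,
  which this deletion may cost, is recovered by using the edge \<open>{u, w}\<close> repeatedly, and the extra
  factor \<open>x_u^t\<close> provides for that. Consequently the variables outside a prime \<open>P\<close> that contains \<open>J\<close> form
  an independent set \<open>F\<close> of \<open>W\<close>. These variables generate the ring modulo \<open>P\<close>, and a chain of
  primes above \<open>P\<close> has length at most \<open>card F\<close> (\<open>prime_chain_length_le\<close>): a longer chain would
  give more elements, algebraically independent modulo \<open>P\<close>, than there are variables left, and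
  counting the monomials of bounded degree excludes this.

  Lower bound. Let \<open>F\<close> be an independent set of \<open>W\<close>, let \<open>{u, v}\<close> be an edge within the cycle and let
  \<open>x\<close> be the product of all variables of \<open>C\<close> times \<open>(x_u x_v)^(t - s - 1)\<close>. A vertex cover contains at least
  \<open>s + 1\<close> vertices of a cycle of length \<open>2s + 1\<close> (\<open>card_cover_odd_cycle\<close>), so \<open>x\<close> lies in \<open>I^(t)\<close>. But
  the edges within \<open>F \<union> C\<close> lie within \<open>C\<close>, and \<open>x\<close> has degree \<open>2t - 1\<close>, so no multiple of \<open>x\<close> by a
  monomial in the variables of \<open>F\<close> lies in \<open>I^t\<close>. Therefore \<open>J\<close> is contained in the prime generated by
  the variables outside \<open>F\<close>, above which there is a chain of primes of length \<open>card F\<close>.\<close>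

section \<open>Quotients of commutative rings\<close>

text \<open>The left-hand side is the scalar product of \<open>r\<close> with the coset of \<open>a\<close> in a quotient module; it is
  the coset of \<open>r \<otimes> a\<close>, since it does not matter which representative of the coset is multiplied.\<close>

lemma (in cring) smult_coset_eq_zero_iff:
  assumes "ideal B R" and r: "r \<in> carrier R" and a: "a \<in> carrier R"
  shows "(\<Union>x\<in>B +> a. B +> (r \<otimes> x)) = B \<longleftrightarrow> r \<otimes> a \<in> B"
proof -
  interpret B: ideal B R by fact
  have "B +> (r \<otimes> x) = B +> (r \<otimes> a)" if x: "x \<in> B +> a" for x
  proof -
    obtain b where b: "b \<in> B" "x = b \<oplus> a" using x by (auto simp: a_r_coset_def')
    then have "r \<otimes> x = r \<otimes> b \<oplus> r \<otimes> a" using r a by (simp add: r_distr)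
    moreover have "r \<otimes> b \<in> B" using b r by (simp add: B.I_l_closed)
    ultimately have "r \<otimes> x \<in> B +> (r \<otimes> a)" by (auto simp: a_r_coset_def')
    with r a show ?thesis by (metis B.a_repr_independence' m_closed)
  qed
  then have "(\<Union>x\<in>B +> a. B +> (r \<otimes> x)) = B +> (r \<otimes> a)" using B.a_rcos_self[OF a] by blast
  also have "\<dots> = B \<longleftrightarrow> r \<otimes> a \<in> B"
    using r a B.a_rcos_self[of "r \<otimes> a"] a_coset_join2[of "r \<otimes> a" B] B.a_subgroup by auto
  finally show ?thesis .
qed

lemma (in cring) annihilator_quotient_module:
  assumes "ideal B R" and "A \<subseteq> carrier R"
  shows "annihilator R (quotient_module R A B) = {r \<in> carrier R. \<forall>a\<in>A. r \<otimes> a \<in> B}"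
proof -
  have "(\<Union>x\<in>B +> a. B +> (r \<otimes> x)) = B \<longleftrightarrow> r \<otimes> a \<in> B" if "r \<in> carrier R" "a \<in> A" for r a
    using smult_coset_eq_zero_iff[OF assms(1) that(1)] that(2) assms(2) by (meson subsetD)
  then have "{r \<in> carrier R. \<forall>a\<in>A. (\<Union>x\<in>B +> a. B +> (r \<otimes> x)) = B} = {r \<in> carrier R. \<forall>a\<in>A. r \<otimes> a \<in> B}"
    by blast
  then show ?thesis by (simp add: annihilator_def quotient_module_def)
qed

lemma (in cring) associated_primes_quotient_ring:
  assumes "ideal B R"
  shows "associated_primes R (quotient_module R (carrier R) B)
    = {P. primeideal P R \<and> (\<exists>y\<in>carrier R. P = {r \<in> carrier R. r \<otimes> y \<in> B})}"
proof -
  have "{r \<in> carrier R. (\<Union>x\<in>B +> y. B +> (r \<otimes> x)) = B} = {r \<in> carrier R. r \<otimes> y \<in> B}"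
    if "y \<in> carrier R" for y
    using smult_coset_eq_zero_iff[OF assms _ that] by blast
  then show ?thesis by (simp add: associated_primes_def quotient_module_def)
qed

text \<open>If \<open>f / 1 = a / s\<close> with \<open>a\<close> in \<open>J\<close>, then some \<open>w\<close> outside \<open>P\<close> satisfies \<open>w s f = w a\<close>, and \<open>w s\<close> is
  outside \<open>P\<close>; conversely \<open>f / 1 = (s f) / s\<close>. This removes fractions from all later arguments.\<close>

lemma (in cring) mem_contraction_of_extension_iff:
  assumes "primeideal P R" and "J \<subseteq> carrier R" and f: "f \<in> carrier R"
    and J: "\<And>a x. a \<in> J \<Longrightarrow> x \<in> carrier R \<Longrightarrow> x \<otimes> a \<in> J"
  shows "f \<in> loc_contraction R P (loc_extension R P J) \<longleftrightarrow> (\<exists>s\<in>carrier R - P. s \<otimes> f \<in> J)"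
proof -
  interpret P: primeideal P R by fact
  have one: "\<one> \<in> carrier R - P" using P.one_imp_carrier P.I_notcarr by auto
  have mult: "w \<otimes> s \<in> carrier R - P" if "w \<in> carrier R - P" "s \<in> carrier R - P" for w s
    using that P.I_prime by auto
  show ?thesis
  proof
    assume "f \<in> loc_contraction R P (loc_extension R P J)"
    then obtain a s where as: "a \<in> J" "s \<in> carrier R - P" "loc_frac R P f \<one> = loc_frac R P a s"
      by (auto simp: loc_contraction_def loc_extension_def)
    have "(f, \<one>) \<in> loc_frac R P f \<one>" using f one by (auto simp: loc_frac_def)
    then obtain w where w: "w \<in> carrier R - P" "w \<otimes> (a \<otimes> \<one>) = w \<otimes> (f \<otimes> s)"
      unfolding as(3) by (auto simp: loc_frac_def)
    have "a \<in> carrier R" using as(1) assms(2) by blast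
    moreover have "w \<otimes> s \<otimes> f = w \<otimes> (f \<otimes> s)" using w(1) as(2) f by (simp add: m_ac)
    ultimately have "w \<otimes> s \<otimes> f = w \<otimes> a" using w by simp
    then have "w \<otimes> s \<otimes> f \<in> J" using J[OF as(1)] w(1) by simp
    then show "\<exists>s\<in>carrier R - P. s \<otimes> f \<in> J" using mult[OF w(1) as(2)] by blast
  next
    assume "\<exists>s\<in>carrier R - P. s \<otimes> f \<in> J"
    then obtain s where s: "s \<in> carrier R - P" "s \<otimes> f \<in> J" by blast
    have "loc_frac R P f \<one> = loc_frac R P (s \<otimes> f) s"
    proof -
      have "(\<exists>w\<in>carrier R - P. w \<otimes> (f \<otimes> u) = w \<otimes> (b \<otimes> \<one>))
          \<longleftrightarrow> (\<exists>w\<in>carrier R - P. w \<otimes> (s \<otimes> f \<otimes> u) = w \<otimes> (b \<otimes> s))" (is "?L \<longleftrightarrow> ?R")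
        if bu: "b \<in> carrier R" "u \<in> carrier R" for b u
      proof
        assume ?L
        then obtain w where w: "w \<in> carrier R - P" "w \<otimes> (f \<otimes> u) = w \<otimes> (b \<otimes> \<one>)" by blast
        have "w \<otimes> (s \<otimes> f \<otimes> u) = s \<otimes> (w \<otimes> (f \<otimes> u))" using w(1) s(1) f bu by (simp add: m_ac)
        also have "\<dots> = w \<otimes> (b \<otimes> s)" unfolding w(2) using w(1) s(1) bu by (simp add: m_ac)
        finally show ?R using w(1) by blast
      next
        assume ?R
        then obtain w where w: "w \<in> carrier R - P" "w \<otimes> (s \<otimes> f \<otimes> u) = w \<otimes> (b \<otimes> s)" by blast
        have "(w \<otimes> s) \<otimes> (f \<otimes> u) = w \<otimes> (s \<otimes> f \<otimes> u)" using w(1) s(1) f bu by (simp add: m_ac)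
        also have "\<dots> = (w \<otimes> s) \<otimes> (b \<otimes> \<one>)" unfolding w(2) using w(1) s(1) bu by (simp add: m_ac)
        finally show ?L using mult[OF w(1) s(1)] by blast
      qed
      then show ?thesis unfolding loc_frac_def by blast
    qed
    then show "f \<in> loc_contraction R P (loc_extension R P J)"
      using s f by (auto simp: loc_contraction_def loc_extension_def)
  qed
qed

text \<open>Primes of the quotient correspond to primes above \<open>J\<close>: preimages are prime, images of primes
  above \<open>J\<close> are prime, and both operations preserve strict inclusions.\<close>

lemma (in cring) krull_dim_quotient:
  assumes J: "ideal J R"
  shows "krull_dim (R Quot J) = Sup (insert (- 1) {ereal (real n) |n.
      \<exists>P. (\<forall>i\<le>n. primeideal (P i) R) \<and> (\<forall>i<n. P i \<subset> P (Suc i)) \<and> J \<subseteq> P 0})"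
proof -
  interpret J: ideal J R by fact
  have quot_zero: "\<zero>\<^bsub>R Quot J\<^esub> = J" by (simp add: FactRing_def)
  interpret hom: ring_hom_cring R "R Quot J" "(+>) J"
    using J.rcos_ring_hom_cring[OF is_cring] .
  have carrier_quot: "carrier (R Quot J) = (+>) J ` carrier R"
    unfolding FactRing_def A_RCOSETS_def' by auto
  have zero: "J +> r = J" if "r \<in> J" for r
    using that J.Icarr by (simp add: a_coset_join2 J.a_subgroup)
  have mem_image: "J +> a \<in> (+>) J ` P \<longleftrightarrow> a \<in> P" if P: "ideal P R" "J \<subseteq> P" and a: "a \<in> carrier R" for P a
  proof
    interpret P: ideal P R by fact
    assume "J +> a \<in> (+>) J ` P"
    then obtain p where p: "p \<in> P" "J +> a = J +> p" by auto
    then have "a \<in> J +> p" using J.a_rcos_self[OF a] by simp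
    then obtain j where "j \<in> J" "a = j \<oplus> p" by (auto simp: a_r_coset_def')
    with P(2) p(1) show "a \<in> P" by auto
  qed auto
  have "(\<exists>Q. (\<forall>i\<le>n. primeideal (Q i) (R Quot J)) \<and> (\<forall>i<n. Q i \<subset> Q (Suc i)))
      \<longleftrightarrow> (\<exists>P. (\<forall>i\<le>n. primeideal (P i) R) \<and> (\<forall>i<n. P i \<subset> P (Suc i)) \<and> J \<subseteq> P 0)" (is "?L \<longleftrightarrow> ?R") for n :: nat
  proof
    assume ?L
    then obtain Q where Q: "\<And>i. i \<le> n \<Longrightarrow> primeideal (Q i) (R Quot J)" "\<And>i. i < n \<Longrightarrow> Q i \<subset> Q (Suc i)" by blast
    define P where "P i = {r \<in> carrier R. J +> r \<in> Q i}" for i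
    have "primeideal (P i) R" if "i \<le> n" for i
      unfolding P_def by (rule ring_hom_ring.primeideal_vimage[OF J.rcos_ring_hom_ring is_cring Q(1)[OF that]])
    moreover have "P i \<subset> P (Suc i)" if i: "i < n" for i
    proof -
      have "Q (Suc i) \<subseteq> carrier (R Quot J)"
        using Q(1)[of "Suc i"] i by (simp add: primeideal_def ideal_def additive_subgroup.a_subset)
      then show ?thesis using Q(2)[OF i] unfolding P_def carrier_quot by blast
    qed
    moreover have "J \<subseteq> P 0"
    proof
      fix r assume r: "r \<in> J"
      have "\<zero>\<^bsub>R Quot J\<^esub> \<in> Q 0"
        using Q(1)[of 0] by (simp add: primeideal_def ideal_def additive_subgroup.zero_closed)
      moreover have "\<zero>\<^bsub>R Quot J\<^esub> = J +> r" unfolding zero[OF r] by (rule quot_zero)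
      ultimately show "r \<in> P 0" unfolding P_def using J.Icarr[OF r] by simp
    qed
    ultimately show ?R by (intro exI[of _ P]) simp
  next
    assume ?R
    then obtain P where P: "\<And>i. i \<le> n \<Longrightarrow> primeideal (P i) R" "\<And>i. i < n \<Longrightarrow> P i \<subset> P (Suc i)" "J \<subseteq> P 0" by blast
    have JP: "J \<subseteq> P i" if "i \<le> n" for i
      using that
    proof (induction i)
      case (Suc i)
      then show ?case using P(2)[of i] by auto
    qed (use P(3) in simp)
    have idl: "ideal (P i) R" if "i \<le> n" for i using P(1)[OF that] by (simp add: primeideal_def)
    have sub: "P i \<subseteq> carrier R" if "i \<le> n" for i
      using idl[OF that] by (simp add: ideal_def additive_subgroup.a_subset)
    have "primeideal ((+>) J ` P i) (R Quot J)" if i: "i \<le> n" for i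
    proof (rule primeidealI)
      interpret Pi: primeideal "P i" R by (rule P(1)[OF i])
      show "ideal ((+>) J ` P i) (R Quot J)"
        using quot_ideal_correspondence[OF J] idl[OF i] JP[OF i] by (auto simp: bij_betw_def)
      show "cring (R Quot J)" by (rule hom.S.is_cring)
      note mem = mem_image[OF idl[OF i] JP[OF i]]
      obtain r where r: "r \<in> carrier R" "r \<notin> P i" using Pi.I_notcarr Pi.a_subset by blast
      then have "J +> r \<in> carrier (R Quot J)" unfolding carrier_quot by (rule_tac imageI)
      with r mem[OF r(1)] show "carrier (R Quot J) \<noteq> (+>) J ` P i" by metis
      fix a b
      assume ab: "a \<in> carrier (R Quot J)" "b \<in> carrier (R Quot J)" "a \<otimes>\<^bsub>R Quot J\<^esub> b \<in> (+>) J ` P i"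
      obtain x where x: "x \<in> carrier R" "a = J +> x" using ab(1) unfolding carrier_quot by (elim imageE)
      obtain y where y: "y \<in> carrier R" "b = J +> y" using ab(2) unfolding carrier_quot by (elim imageE)
      have "J +> (x \<otimes> y) \<in> (+>) J ` P i" using ab(3) x y hom.hom_mult[OF x(1) y(1)] by metis
      then have "x \<otimes> y \<in> P i" using mem x(1) y(1) by (metis m_closed)
      then have "x \<in> P i \<or> y \<in> P i" using Pi.I_prime x(1) y(1) by metis
      then show "a \<in> (+>) J ` P i \<or> b \<in> (+>) J ` P i" unfolding x(2) y(2) by (metis imageI)
    qed
    moreover have "(+>) J ` P i \<subset> (+>) J ` P (Suc i)" if i: "i < n" for i
    proof -
      obtain a where a: "a \<in> P (Suc i)" "a \<notin> P i" using P(2)[OF i] by blast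
      then have "J +> a \<notin> (+>) J ` P i"
        using mem_image[OF idl[of i] JP[of i], of a] i sub[of "Suc i"] by (metis Suc_leI less_imp_le subsetD)
      moreover have "J +> a \<in> (+>) J ` P (Suc i)" using a(1) by (rule imageI)
      moreover have "(+>) J ` P i \<subseteq> (+>) J ` P (Suc i)" using P(2)[OF i] by (intro image_mono) (rule psubset_imp_subset)
      ultimately show ?thesis by (metis psubsetI)
    qed
    ultimately show ?L by (intro exI[of _ "\<lambda>i. (+>) J ` P i"]) simp
  qed
  then show ?thesis by (simp add: krull_dim_def)
qed

section \<open>Exponent vectors, vertex covers and packings of edges\<close>

definition deg_on :: "'v set \<Rightarrow> ('v::finite \<Rightarrow>\<^sub>0 nat) \<Rightarrow> nat" where
  "deg_on A m = (\<Sum>v\<in>A. Poly_Mapping.lookup m v)"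

lemma deg_on_add: "deg_on A (m + n) = deg_on A m + deg_on A n"
  by (simp add: deg_on_def lookup_add sum.distrib)

lemma deg_on_single: "deg_on A (Poly_Mapping.single v k) = (if v \<in> A then k else 0)"
  by (simp add: deg_on_def lookup_single when_def)

lemma deg_on_eq_0_iff: "deg_on A m = 0 \<longleftrightarrow> Poly_Mapping.keys m \<inter> A = {}"
  by (auto simp: deg_on_def in_keys_iff)

lemma deg_on_sum: "deg_on A (\<Sum>i\<in>J. f i) = (\<Sum>i\<in>J. deg_on A (f i))"
  unfolding deg_on_def lookup_sum by (rule sum.swap)

lemma deg_on_sum_single:
  fixes B :: "'v::finite set"
  shows "deg_on A (\<Sum>v\<in>B. Poly_Mapping.single v k) = k * card (A \<inter> B)"
  by (simp add: deg_on_sum deg_on_single sum.If_cases Int_commute)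

definition vertex_cover :: "'v set set \<Rightarrow> 'v set \<Rightarrow> bool" where
  "vertex_cover E A \<longleftrightarrow> (\<forall>e\<in>E. e \<inter> A \<noteq> {})"

text \<open>The exponents of the monomials in the \<open>t\<close>-th power of the edge ideal: those that dominate the sum
  of \<open>t\<close> edges, repetitions allowed.\<close>

primrec edge_power_exponents :: "'v::finite set set \<Rightarrow> nat \<Rightarrow> ('v \<Rightarrow>\<^sub>0 nat) set" where
  "edge_power_exponents E 0 = UNIV"
| "edge_power_exponents E (Suc t) =
    {m + (Poly_Mapping.single u 1 + Poly_Mapping.single v 1) |m u v. m \<in> edge_power_exponents E t \<and> {u, v} \<in> E}"

lemma edge_power_exponents_upward:
  "m \<in> edge_power_exponents E t \<Longrightarrow> m + n \<in> edge_power_exponents E t"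
proof (induction t arbitrary: m)
  case (Suc t)
  then obtain m' u v where m: "m = m' + (Poly_Mapping.single u 1 + Poly_Mapping.single v 1)"
    "m' \<in> edge_power_exponents E t" "{u, v} \<in> E" by auto
  have "m + n = (m' + n) + (Poly_Mapping.single u 1 + Poly_Mapping.single v 1)" by (simp add: m ac_simps)
  with Suc.IH[OF m(2)] m(3) show ?case by auto
qed simp

lemma edge_power_exponents_mono:
  "E' \<subseteq> E \<Longrightarrow> edge_power_exponents E' t \<subseteq> edge_power_exponents E t"
  by (induction t) fastforce+

lemma edge_power_exponents_edges:
  "m \<in> edge_power_exponents E t \<Longrightarrow> {u, v} \<in> E \<Longrightarrow>
    m + (Poly_Mapping.single u k + Poly_Mapping.single v k) \<in> edge_power_exponents E (t + k)"
proof (induction k)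
  case (Suc k)
  have "m + (Poly_Mapping.single u (Suc k) + Poly_Mapping.single v (Suc k))
    = (m + (Poly_Mapping.single u k + Poly_Mapping.single v k)) + (Poly_Mapping.single u 1 + Poly_Mapping.single v 1)"
    using single_add[of u k 1] single_add[of v k 1] by (simp add: ac_simps)
  with Suc show ?case by auto
qed simp

lemma edge_power_exponents_single_edge:
  "{u, v} \<in> E \<Longrightarrow> m + (Poly_Mapping.single u k + Poly_Mapping.single v k) \<in> edge_power_exponents E k"
  using edge_power_exponents_edges[of m E 0 u v k] by simp

text \<open>Extend a longest path at its first vertex \<open>p ! 0\<close>: that vertex has a neighbour \<open>y\<close> other than \<open>p ! 1\<close>,
  and since the path cannot be prolonged, \<open>y\<close> is on it and closes a cycle.\<close>

lemma cycle_if_no_leaf: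
  fixes E :: "'v::finite set set"
  assumes simple: "simple_graph E" and ne: "E \<noteq> {}"
    and no_leaf: "\<And>v u. {v, u} \<in> E \<Longrightarrow> \<exists>e\<in>E. v \<in> e \<and> e \<noteq> {v, u}"
  shows "\<exists>c. graph_cycle E c"
proof -
  define path where "path p \<longleftrightarrow> distinct p \<and> 2 \<le> length p \<and> (\<forall>i. Suc i < length p \<longrightarrow> {p ! i, p ! Suc i} \<in> E)"
    for p
  obtain u v where uv: "{u, v} \<in> E" "u \<noteq> v"
    using ne simple unfolding simple_graph_def card_2_iff by (metis ex_in_conv)
  have "path [u, v]" using uv by (simp add: path_def)
  moreover have "length p < Suc (card (UNIV::'v set))" if "path p" for p :: "'v list"
    using that distinct_card[of p] card_mono[of UNIV "set p"] by (simp add: path_def)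
  ultimately obtain p where p: "path p" and longest: "\<And>q. path q \<Longrightarrow> length q \<le> length p"
    using ex_has_greatest_nat[of path "[u,v]" length "Suc (card (UNIV::'v set))"] by (metis less_imp_le)
  have "{p ! 0, p ! 1} \<in> E" using p by (auto simp: path_def)
  then obtain e where e: "e \<in> E" "p ! 0 \<in> e" "e \<noteq> {p ! 0, p ! 1}" using no_leaf by blast
  from e simple obtain y where y: "e = {p ! 0, y}" "y \<noteq> p ! 0"
    unfolding simple_graph_def card_2_iff by (metis doubleton_eq_iff insert_iff singletonD)
  have "y \<in> set p"
  proof (rule ccontr)
    assume "y \<notin> set p"
    have "{(y # p) ! i, (y # p) ! Suc i} \<in> E" if "Suc i < length (y # p)" for i
      using that p e y by (cases i) (auto simp: path_def insert_commute)
    with p \<open>y \<notin> set p\<close> have "path (y # p)" by (simp add: path_def)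
    from longest[OF this] show False by simp
  qed
  then obtain i where i: "i < length p" "p ! i = y" by (auto simp: in_set_conv_nth)
  have i2: "2 \<le> i"
  proof (rule ccontr)
    assume "\<not> 2 \<le> i" then have "i = 0 \<or> i = 1" by linarith
    then show False using i y e by auto
  qed
  define c where "c = take (Suc i) p"
  have len: "length c = Suc i" using i by (simp add: c_def)
  have "{c ! j, c ! (Suc j mod length c)} \<in> E" if "j < length c" for j
  proof (cases "j = i")
    case True
    then show ?thesis using e y i by (simp add: len) (simp add: c_def insert_commute)
  next
    case False
    then show ?thesis using that p i by (simp add: len) (simp add: c_def path_def)
  qed
  then have "cycle_edges c \<subseteq> E" by (auto simp: cycle_edges_def)
  then have "graph_cycle E c" using len i2 p by (simp add: graph_cycle_def) (simp add: c_def path_def)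
  then show ?thesis ..
qed

text \<open>Koenig's duality in weighted form: in a forest one can pack as many edges into an exponent vector
  as the least weight of a vertex cover. At a leaf \<open>v\<close> with neighbour \<open>u\<close> the edge \<open>{v, u}\<close> is used as
  often as the weights of \<open>v\<close> and \<open>u\<close> permit, say \<open>k\<close> times. Every cover of the remaining edges
  yields a cover \<open>B\<close> of all edges that contains at most one of \<open>u\<close>, \<open>v\<close> and whose remaining weight is no
  larger, so that the least weight drops by at most \<open>k\<close>.\<close>

lemma forest_matching:
  fixes E :: "'v::finite set set"
  assumes "simple_graph E" and "\<nexists>c. graph_cycle E c"
    and "\<And>A. vertex_cover E A \<Longrightarrow> t \<le> deg_on A m"
  shows "m \<in> edge_power_exponents E t"
  using finite[of E] assms
proof (induction E arbitrary: m t rule: finite_psubset_induct)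
  case (psubset E)
  show ?case
  proof (cases "E = {}")
    case True
    then show ?thesis using psubset.prems(3)[of "{}"] by (simp add: vertex_cover_def deg_on_def)
  next
    case False
    then obtain v u where leaf: "{v, u} \<in> E" "\<And>e. e \<in> E \<Longrightarrow> v \<in> e \<Longrightarrow> e = {v, u}"
      using cycle_if_no_leaf[OF psubset.prems(1)] psubset.prems(2) by blast
    have vu: "v \<noteq> u" using leaf(1) psubset.prems(1) by (auto simp: simple_graph_def)
    define E' where "E' = E - {{v, u}}"
    define k where "k = min (Poly_Mapping.lookup m v) (Poly_Mapping.lookup m u)"
    define m' where "m' = m - (Poly_Mapping.single v k + Poly_Mapping.single u k)"
    have m: "m = m' + (Poly_Mapping.single v k + Poly_Mapping.single u k)"
      using vu by (intro poly_mapping_eqI)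
        (auto simp: m'_def lookup_add lookup_minus lookup_single when_def k_def)
    have l: "Poly_Mapping.lookup m v = Poly_Mapping.lookup m' v + k"
            "Poly_Mapping.lookup m u = Poly_Mapping.lookup m' u + k"
      using vu by (simp_all add: m lookup_add lookup_single)
    have k_cases: "k = Poly_Mapping.lookup m v \<or> k = Poly_Mapping.lookup m u"
      unfolding k_def by linarith
    have "t - k \<le> deg_on A m'" if A: "vertex_cover E' A" for A
    proof -
      have drop: "deg_on (A - {v}) m' \<le> deg_on A m'"
        unfolding deg_on_def by (rule sum_mono2) auto
      have insdeg: "deg_on (insert x B) m' \<le> deg_on B m' + Poly_Mapping.lookup m' x" for x B
        unfolding deg_on_def by (cases "x \<in> B") (auto simp: insert_absorb)
      \<comment> \<open>Replace \<open>v\<close> by \<open>u\<close> if possible. If \<open>u\<close> is not in \<open>A\<close>, one of the two vertices must be added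
        to cover \<open>{v, u}\<close>; one of them has no weight left, by the choice of \<open>k\<close>.\<close>
      have "\<exists>B. vertex_cover E B \<and> deg_on B m' \<le> deg_on A m' \<and> card (B \<inter> {u, v}) \<le> 1"
      proof (cases "u \<in> A")
        case True
        have "vertex_cover E (A - {v})"
          unfolding vertex_cover_def
        proof
          fix e assume e: "e \<in> E"
          show "e \<inter> (A - {v}) \<noteq> {}"
          proof (cases "v \<in> e")
            case True
            with leaf(2)[OF e] \<open>u \<in> A\<close> vu show ?thesis by auto
          next
            case False
            with e have "e \<in> E'" by (auto simp: E'_def)
            with A have "e \<inter> A \<noteq> {}" by (simp add: vertex_cover_def)
            with False show ?thesis by blast
          qed
        qed
        moreover have "(A - {v}) \<inter> {u, v} \<subseteq> {u}" by auto
        then have "card ((A - {v}) \<inter> {u, v}) \<le> card {u}" by (intro card_mono) auto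
        ultimately show ?thesis using drop by (intro exI[of _ "A - {v}"]) auto
      next
        case u: False
        show ?thesis
        proof (cases "Poly_Mapping.lookup m' v = 0")
          case True
          have "vertex_cover E (insert v A)" using A by (auto simp: vertex_cover_def E'_def)
          moreover have "insert v A \<inter> {u, v} \<subseteq> {v}" using u by auto
          then have "card (insert v A \<inter> {u, v}) \<le> card {v}" by (intro card_mono) auto
          ultimately show ?thesis using insdeg[of v A] True by (intro exI[of _ "insert v A"]) auto
        next
          case False
          then have u0: "Poly_Mapping.lookup m' u = 0" using l k_cases by linarith
          have "vertex_cover E (insert u (A - {v}))"
            unfolding vertex_cover_def
          proof
            fix e assume e: "e \<in> E"
            show "e \<inter> insert u (A - {v}) \<noteq> {}"
            proof (cases "v \<in> e")
              case True
              with leaf(2)[OF e] show ?thesis by auto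
            next
              case False
              with e have "e \<in> E'" by (auto simp: E'_def)
              with A have "e \<inter> A \<noteq> {}" by (simp add: vertex_cover_def)
              with False show ?thesis by blast
            qed
          qed
          moreover have "insert u (A - {v}) \<inter> {u, v} \<subseteq> {u}" using u by auto
          then have "card (insert u (A - {v}) \<inter> {u, v}) \<le> card {u}" by (intro card_mono) auto
          ultimately show ?thesis using insdeg[of u "A - {v}"] drop u0 by (intro exI[of _ "insert u (A - {v})"]) auto
        qed
      qed
      then obtain B where B: "vertex_cover E B" "deg_on B m' \<le> deg_on A m'" "card (B \<inter> {u, v}) \<le> 1" by blast
      have "deg_on B m \<le> deg_on B m' + k"
        using B(3) vu by (auto simp: m deg_on_add deg_on_single)
      with psubset.prems(3)[OF B(1)] B(2) show ?thesis by linarith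
    qed
    then have "m' \<in> edge_power_exponents E' (t - k)"
      using psubset.prems(1,2) leaf(1)
      by (intro psubset.IH) (auto simp: E'_def simple_graph_def graph_cycle_def)
    then have "m' \<in> edge_power_exponents E (t - k)"
      using edge_power_exponents_mono[of E' E] by (auto simp: E'_def)
    from edge_power_exponents_edges[OF this leaf(1), of "min k t"]
    have "m' + (Poly_Mapping.single v (min k t) + Poly_Mapping.single u (min k t)) \<in> edge_power_exponents E t"
      by (simp add: min_def split: if_splits)
    from edge_power_exponents_upward[OF this, of "Poly_Mapping.single v (k - t) + Poly_Mapping.single u (k - t)"]
    have "m' + (Poly_Mapping.single v (min k t) + Poly_Mapping.single v (k - t)
        + (Poly_Mapping.single u (min k t) + Poly_Mapping.single u (k - t))) \<in> edge_power_exponents E t"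
      by (simp add: ac_simps)
    moreover have "min k t + (k - t) = k" by simp
    ultimately show ?thesis by (simp only: m flip: single_add)
  qed
qed

text \<open>The vertex \<open>w\<close> lies on the only cycle, so the edges avoiding \<open>w\<close> form a forest; a cover of these
  together with \<open>w\<close> covers all edges. Hence \<open>t - k\<close> edges avoiding \<open>w\<close> can be packed, \<open>k\<close> being the
  weight of \<open>w\<close> cut off at \<open>t\<close>, and the edge \<open>{u, w}\<close> taken \<open>k\<close> times completes them. The remaining
  edges may already exhaust \<open>m\<close> at \<open>u\<close>, which is why \<open>u\<close> is given extra weight.\<close>

lemma power_near_cycle:
  fixes E :: "'v::finite set set"
  assumes "simple_graph E" and "unicyclic E" and "graph_cycle E c"
    and w: "w \<in> set c" and u: "{u, w} \<in> E"
    and cov: "\<And>A. vertex_cover E A \<Longrightarrow> t \<le> deg_on A m"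
  shows "m + Poly_Mapping.single u t \<in> edge_power_exponents E t"
proof -
  define E' where "E' = {e \<in> E. w \<notin> e}"
  define k where "k = min t (Poly_Mapping.lookup m w)"
  define m' where "m' = m - Poly_Mapping.single w k"
  have m: "m = m' + Poly_Mapping.single w k"
    by (intro poly_mapping_eqI) (auto simp: m'_def lookup_add lookup_minus lookup_single when_def k_def)
  obtain i where i: "i < length c" "c ! i = w" using w by (auto simp: in_set_conv_nth)
  have "{w, c ! (Suc i mod length c)} \<in> cycle_edges c" using i by (auto simp: cycle_edges_def)
  then have "\<not> cycle_edges c \<subseteq> E'" by (auto simp: E'_def)
  have "cycle_edges d = cycle_edges c" if "graph_cycle E d" for d
    using assms(2,3) that unfolding unicyclic_def by metis
  moreover have "graph_cycle E d \<and> cycle_edges d \<subseteq> E'" if "graph_cycle E' d" for d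
    using that by (auto simp: graph_cycle_def E'_def)
  ultimately have "\<nexists>d. graph_cycle E' d" using \<open>\<not> cycle_edges c \<subseteq> E'\<close> by blast
  moreover have "t - k \<le> deg_on A m'" if "vertex_cover E' A" for A
  proof -
    have "vertex_cover E (insert w A)" using that by (auto simp: vertex_cover_def E'_def)
    from cov[OF this] have "t \<le> deg_on (insert w A) m" .
    also have "\<dots> = Poly_Mapping.lookup m w + deg_on (A - {w}) m"
      unfolding deg_on_def by (simp add: sum.insert_remove)
    also have "deg_on (A - {w}) m = deg_on (A - {w}) m'" by (simp add: m deg_on_add deg_on_single)
    also have "\<dots> \<le> deg_on A m'" unfolding deg_on_def by (rule sum_mono2) auto
    finally show ?thesis by (auto simp: k_def)
  qed
  moreover have "simple_graph E'" using assms(1) by (auto simp: simple_graph_def E'_def)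
  ultimately have "m' \<in> edge_power_exponents E' (t - k)" by (intro forest_matching) auto
  then have "m' \<in> edge_power_exponents E (t - k)"
    using edge_power_exponents_mono[of E' E] by (auto simp: E'_def)
  from edge_power_exponents_edges[OF this u, of k]
  have "m' + (Poly_Mapping.single u k + Poly_Mapping.single w k) \<in> edge_power_exponents E t"
    by (simp add: k_def)
  from edge_power_exponents_upward[OF this, of "Poly_Mapping.single u (t - k)"]
  have "m' + (Poly_Mapping.single w k + (Poly_Mapping.single u k + Poly_Mapping.single u (t - k))) \<in> edge_power_exponents E t"
    by (simp add: ac_simps)
  moreover have "Poly_Mapping.single u k + Poly_Mapping.single u (t - k) = Poly_Mapping.single u t"
    by (simp add: k_def flip: single_add)
  ultimately show ?thesis by (simp add: m ac_simps)
qed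

text \<open>Each unit of weight on \<open>A\<close> is completed to an edge by a vertex outside \<open>A\<close>. In the localization at
  the prime of \<open>A\<close>, where the variables outside \<open>A\<close> are units, this says that the power of the edge
  ideal is the power of the prime.\<close>

lemma irredundant_cover_power:
  fixes E :: "'v::finite set set"
  assumes "\<And>u. u \<in> A \<Longrightarrow> \<exists>v. v \<notin> A \<and> {u, v} \<in> E" and "t \<le> deg_on A m"
  shows "m + (\<Sum>v\<in>-A. Poly_Mapping.single v t) \<in> edge_power_exponents E t"
  using assms(2)
proof (induction t arbitrary: m)
  case (Suc t)
  then have "deg_on A m \<noteq> 0" by simp
  then obtain u where u: "u \<in> A" "Poly_Mapping.lookup m u \<noteq> 0" by (auto simp: deg_on_def)
  obtain v where v: "v \<notin> A" "{u, v} \<in> E" using assms(1) u by blast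
  define m' where "m' = m - Poly_Mapping.single u 1"
  have m: "m = m' + Poly_Mapping.single u 1"
    using u by (intro poly_mapping_eqI) (auto simp: m'_def lookup_add lookup_minus lookup_single when_def)
  have "t \<le> deg_on A m'" using Suc.prems u by (simp add: m deg_on_add deg_on_single)
  from Suc.IH[OF this] have "m' + (\<Sum>v\<in>-A. Poly_Mapping.single v t) \<in> edge_power_exponents E t" .
  then have *: "m' + (\<Sum>v\<in>-A. Poly_Mapping.single v t) + (\<Sum>v\<in>-A-{v}. Poly_Mapping.single v 1) \<in> edge_power_exponents E t"
    by (rule edge_power_exponents_upward)
  have "(\<Sum>v\<in>-A. Poly_Mapping.single v (Suc t)) = (\<Sum>v\<in>-A. Poly_Mapping.single v t) + (\<Sum>v\<in>-A. Poly_Mapping.single v (1::nat))"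
    by (simp flip: sum.distrib single_add)
  also have "(\<Sum>v\<in>-A. Poly_Mapping.single v (1::nat)) = Poly_Mapping.single v 1 + (\<Sum>v\<in>-A-{v}. Poly_Mapping.single v 1)"
    using v by (intro sum.remove) auto
  finally have "m + (\<Sum>v\<in>-A. Poly_Mapping.single v (Suc t)) = (m' + (\<Sum>v\<in>-A. Poly_Mapping.single v t) + (\<Sum>v\<in>-A-{v}. Poly_Mapping.single v 1))
     + (Poly_Mapping.single u 1 + Poly_Mapping.single v 1)"
    by (simp add: m ac_simps)
  with * v show ?case by auto
qed simp

text \<open>Each of the \<open>2 * s + 1\<close> edges of the cycle has an endpoint in \<open>A\<close>, while each vertex of
  the cycle lies on exactly two of them.\<close>

lemma card_cover_odd_cycle:
  fixes E :: "'v::finite set set"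
  assumes c: "graph_cycle E c" and len: "length c = 2 * s + 1" and A: "vertex_cover E A"
  shows "s + 1 \<le> card (A \<inter> set c)"
proof -
  let ?n = "length c" and ?a = "\<lambda>i. if c ! i \<in> A then 1 else 0 :: nat"
  have d: "distinct c" using c by (simp add: graph_cycle_def)
  have "?n = (\<Sum>i<?n. 1)" by simp
  also have "\<dots> \<le> (\<Sum>i<?n. ?a i + ?a (Suc i mod ?n))"
  proof (rule sum_mono)
    fix i assume "i \<in> {..<?n}"
    then have "{c ! i, c ! (Suc i mod ?n)} \<in> E" using c by (auto simp: graph_cycle_def cycle_edges_def)
    then have "{c ! i, c ! (Suc i mod ?n)} \<inter> A \<noteq> {}" using A by (auto simp: vertex_cover_def)
    then show "1 \<le> ?a i + ?a (Suc i mod ?n)" by auto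
  qed
  also have "\<dots> = (\<Sum>i<?n. ?a i) + (\<Sum>i<?n. ?a (Suc i mod ?n))" by (rule sum.distrib)
  also have "(\<Sum>i<?n. ?a (Suc i mod ?n)) = (\<Sum>i<?n. ?a i)"
  proof -
    have "(\<Sum>i<Suc (2*s). ?a (Suc i mod ?n)) = ?a 0 + (\<Sum>i<2*s. ?a (Suc i))"
      unfolding sum.lessThan_Suc using len by (simp add: add.commute)
    also have "\<dots> = (\<Sum>i<Suc (2*s). ?a i)" by (rule sum.lessThan_Suc_shift[symmetric])
    finally show ?thesis using len by simp
  qed
  also have "(\<Sum>i<?n. ?a i) = card (A \<inter> set c)"
  proof -
    have "(\<Sum>i<?n. ?a i) = (\<Sum>v\<in>set c. if v \<in> A then 1 else 0)"
      using d bij_betw_nth[of c "{..<?n}" "set c"] by (intro sum.reindex_bij_betw) auto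
    then show ?thesis by (simp add: sum.If_cases Int_commute)
  qed
  finally show ?thesis using len by simp
qed

text \<open>Every edge that fits into \<open>m\<close> lies within \<open>F \<union> C\<close>, hence within \<open>C\<close>, and contributes \<open>2\<close> to the
  degree on \<open>C\<close>.\<close>

lemma deg_on_of_edge_power:
  fixes E :: "'v::finite set set"
  assumes ind: "\<And>e. e \<in> E \<Longrightarrow> e \<subseteq> F \<union> C \<Longrightarrow> e \<subseteq> C"
  shows "m \<in> edge_power_exponents E t \<Longrightarrow> Poly_Mapping.keys m \<subseteq> F \<union> C \<Longrightarrow> 2 * t \<le> deg_on C m"
proof (induction t arbitrary: m)
  case (Suc t)
  then obtain m' u v where m: "m = m' + (Poly_Mapping.single u 1 + Poly_Mapping.single v 1)"
    "m' \<in> edge_power_exponents E t" "{u, v} \<in> E" by auto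
  have "Poly_Mapping.keys m = Poly_Mapping.keys m' \<union> {u, v}"
    by (auto simp: m in_keys_iff lookup_add lookup_single when_def split: if_splits)
  with Suc.prems have k: "Poly_Mapping.keys m' \<subseteq> F \<union> C" "{u, v} \<subseteq> F \<union> C" by auto
  from ind[OF m(3) k(2)] Suc.IH[OF m(2) k(1)] show ?case
    by (simp add: m deg_on_add deg_on_single)
qed simp

section \<open>Ideals of a ring given by a type class\<close>

lemma carrier_type_algebra [simp]: "carrier (ring_of_type_algebra :: 'a::comm_ring_1 ring) = UNIV"
  and mult_type_algebra [simp]: "x \<otimes>\<^bsub>ring_of_type_algebra\<^esub> y = x * (y::'a)"
  and one_type_algebra [simp]: "\<one>\<^bsub>ring_of_type_algebra\<^esub> = (1::'a)"
  and add_type_algebra [simp]: "x \<oplus>\<^bsub>ring_of_type_algebra\<^esub> y = x + (y::'a)"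
  and zero_type_algebra [simp]: "\<zero>\<^bsub>ring_of_type_algebra\<^esub> = (0::'a)"
  by (simp_all add: ring_of_type_algebra_def)

lemma ideal_type_algebraI:
  fixes J :: "'a::comm_ring_1 set"
  assumes "0 \<in> J" and "\<And>x y. x \<in> J \<Longrightarrow> y \<in> J \<Longrightarrow> x + y \<in> J" and "\<And>x r. x \<in> J \<Longrightarrow> r * x \<in> J"
  shows "ideal J ring_of_type_algebra"
proof -
  interpret R: cring "ring_of_type_algebra :: 'a ring" by (rule cring_from_type_algebra)
  have minus: "\<ominus>\<^bsub>ring_of_type_algebra\<^esub> x = - x" for x :: 'a
    by (rule R.minus_equality) simp_all
  show ?thesis
  proof (rule idealI)
    show "subgroup J (add_monoid (ring_of_type_algebra :: 'a ring))"
    proof (rule R.add.subgroupI)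
      fix a assume "a \<in> J"
      then show "\<ominus>\<^bsub>ring_of_type_algebra\<^esub> a \<in> J" using assms(3)[of a "-1"] by (simp add: minus)
    qed (use assms in auto)
  qed (use assms R.ring_axioms in \<open>auto simp: mult.commute\<close>)
qed

lemma ideal_type_algebraD:
  fixes J :: "'a::comm_ring_1 set"
  assumes "ideal J ring_of_type_algebra"
  shows "0 \<in> J" and "x \<in> J \<Longrightarrow> y \<in> J \<Longrightarrow> x + y \<in> J" and "x \<in> J \<Longrightarrow> r * x \<in> J"
    and "x \<in> J \<Longrightarrow> y \<in> J \<Longrightarrow> x - y \<in> J"
proof -
  interpret J: ideal J "ring_of_type_algebra :: 'a ring" by fact
  show "0 \<in> J" using additive_subgroup.zero_closed[OF J.is_additive_subgroup] unfolding zero_type_algebra .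
  have add: "a + b \<in> J" if "a \<in> J" "b \<in> J" for a b
    using additive_subgroup.a_closed[OF J.is_additive_subgroup that] unfolding add_type_algebra .
  have mult: "r * a \<in> J" if "a \<in> J" for a r using J.I_l_closed[of a r] that by simp
  show "x + y \<in> J" if "x \<in> J" "y \<in> J" using add that .
  show "r * x \<in> J" if "x \<in> J" using mult that .
  show "x - y \<in> J" if "x \<in> J" "y \<in> J" using add[OF that(1) mult[OF that(2), of "-1"]] by simp
qed

lemma ideal_type_algebra_sum:
  fixes J :: "'a::comm_ring_1 set"
  assumes "ideal J ring_of_type_algebra" and "\<And>i. i \<in> A \<Longrightarrow> f i \<in> J"
  shows "sum f A \<in> J"
  using assms(2) by (induction A rule: infinite_finite_induct) (auto simp: ideal_type_algebraD[OF assms(1)])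

lemma primeideal_type_algebraD:
  fixes P :: "'a::comm_ring_1 set"
  assumes "primeideal P ring_of_type_algebra"
  shows "ideal P ring_of_type_algebra" and "1 \<notin> P" and "x * y \<in> P \<Longrightarrow> x \<in> P \<or> y \<in> P"
proof -
  interpret P: primeideal P "ring_of_type_algebra :: 'a ring" by fact
  show "ideal P ring_of_type_algebra" by (rule P.is_ideal)
  show "1 \<notin> P" using P.one_imp_carrier P.I_notcarr by auto
  show "x * y \<in> P \<Longrightarrow> x \<in> P \<or> y \<in> P" using P.I_prime[of x y] by simp
qed

lemma primeideal_type_algebra_power:
  fixes P :: "'a::comm_ring_1 set"
  assumes "primeideal P ring_of_type_algebra" and "x ^ n \<in> P"
  shows "x \<in> P"
  using assms(2) by (induction n) (use primeideal_type_algebraD[OF assms(1)] in auto)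

section \<open>Monomial ideals of the polynomial ring\<close>

lemma sum_of_monomials:
  "(\<Sum>m\<in>Poly_Mapping.keys p. Poly_Mapping.single m (Poly_Mapping.lookup p m)) = p"
  by (rule poly_mapping_eqI) (simp add: lookup_sum lookup_single when_def in_keys_iff)

text \<open>The semigroup of exponents has unique products. Numbering the variables embeds it additively into
  \<open>nat \<Rightarrow>\<^sub>0 nat\<close>, which carries a linear order compatible with addition; \<open>a\<close> and \<open>b\<close> are chosen largest
  in this order.\<close>

lemma exists_unique_sum:
  fixes A B :: "('v::finite \<Rightarrow>\<^sub>0 nat) set"
  assumes "finite A" "finite B" "A \<noteq> {}" "B \<noteq> {}"
  obtains a b where "a \<in> A" "b \<in> B" "\<And>a' b'. a' \<in> A \<Longrightarrow> b' \<in> B \<Longrightarrow> a' + b' = a + b \<Longrightarrow> a' = a \<and> b' = b"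
proof -
  obtain idx :: "'v \<Rightarrow> nat" where idx: "inj idx"
    using finite_imp_inj_to_nat_seg[OF finite_UNIV] by metis
  define code where "code m = (\<Sum>v\<in>UNIV. Poly_Mapping.single (idx v) (Poly_Mapping.lookup m v))" for m :: "'v \<Rightarrow>\<^sub>0 nat"
  have add: "code (m + n) = code m + code n" for m n
    by (simp add: code_def lookup_add single_add sum.distrib)
  have "Poly_Mapping.lookup (code m) (idx v) = Poly_Mapping.lookup m v" for m v
    using idx by (simp add: code_def lookup_sum lookup_single when_def inj_eq)
  then have inj: "code m = code n \<Longrightarrow> m = n" for m n by (metis poly_mapping_eqI)
  have max: "\<exists>x. x \<in> Z \<and> (\<forall>y. y \<in> Z \<longrightarrow> code y \<le> code x)" if Z: "finite Z" "Z \<noteq> {}" for Z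
  proof -
    have "Max (code ` Z) \<in> code ` Z" using Z by (intro Max_in) auto
    then obtain x where "x \<in> Z" "Max (code ` Z) = code x" by auto
    moreover have "code y \<le> Max (code ` Z)" if "y \<in> Z" for y using Z that by (intro Max_ge) auto
    ultimately show ?thesis by auto
  qed
  from max assms obtain a b where ab: "a \<in> A" "\<And>y. y \<in> A \<Longrightarrow> code y \<le> code a" "b \<in> B" "\<And>y. y \<in> B \<Longrightarrow> code y \<le> code b"
    by meson
  have "a' = a \<and> b' = b" if "a' \<in> A" "b' \<in> B" "a' + b' = a + b" for a' b'
  proof -
    have "code a' + code b' = code a + code b" using that(3) by (metis add)
    moreover have le: "code a' \<le> code a" "code b' \<le> code b" using ab that by auto
    ultimately have "code a' = code a" "code b' = code b"
      by (metis add_less_le_mono add_le_less_mono order.not_eq_order_implies_strict order.irrefl)+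
    then show ?thesis using inj by blast
  qed
  with ab show ?thesis using that by blast
qed

text \<open>The parts of \<open>f\<close> and \<open>g\<close> of least degree on \<open>A\<close> have a nonzero product, since one of its
  coefficients is a single product of coefficients, and it is the part of \<open>f * g\<close> of least degree.
  For \<open>d = e = 0\<close> this says that the variables in \<open>A\<close> generate a prime ideal; the general case shows
  that multiplication by an element outside that prime cannot raise the least degree on \<open>A\<close>.\<close>

lemma low_degree_exponent_of_product:
  fixes f g :: "('v::finite, 'k::field) mpolynomial"
  assumes f: "\<exists>m\<in>Poly_Mapping.keys f. deg_on A m \<le> d" and g: "\<exists>m\<in>Poly_Mapping.keys g. deg_on A m \<le> e"
  shows "\<exists>m\<in>Poly_Mapping.keys (f * g). deg_on A m \<le> d + e"
proof -
  have lowest: "\<exists>n\<in>Poly_Mapping.keys h. deg_on A n \<le> k \<and> (\<forall>m\<in>Poly_Mapping.keys h. deg_on A n \<le> deg_on A m)"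
    if "\<exists>m\<in>Poly_Mapping.keys h. deg_on A m \<le> k" for h :: "('v, 'k) mpolynomial" and k
  proof -
    from that obtain m where m: "m \<in> Poly_Mapping.keys h" "deg_on A m \<le> k" by blast
    obtain n where "n \<in> Poly_Mapping.keys h" "\<And>m. m \<in> Poly_Mapping.keys h \<Longrightarrow> deg_on A n \<le> deg_on A m"
      using ex_has_least_nat[of "\<lambda>m. m \<in> Poly_Mapping.keys h" m "deg_on A"] m by blast
    with m show ?thesis by (meson order.trans)
  qed
  obtain m0 where m0: "m0 \<in> Poly_Mapping.keys f" "deg_on A m0 \<le> d" "\<And>m. m \<in> Poly_Mapping.keys f \<Longrightarrow> deg_on A m0 \<le> deg_on A m"
    using lowest[OF f] by blast
  obtain n0 where n0: "n0 \<in> Poly_Mapping.keys g" "deg_on A n0 \<le> e" "\<And>m. m \<in> Poly_Mapping.keys g \<Longrightarrow> deg_on A n0 \<le> deg_on A m"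
    using lowest[OF g] by blast
  define F where "F = {m \<in> Poly_Mapping.keys f. deg_on A m = deg_on A m0}"
  define G where "G = {m \<in> Poly_Mapping.keys g. deg_on A m = deg_on A n0}"
  have "F \<noteq> {}" "G \<noteq> {}" "finite F" "finite G" using m0 n0 by (auto simp: F_def G_def)
  then obtain a b where ab: "a \<in> F" "b \<in> G"
    and uniq: "\<And>a' b'. a' \<in> F \<Longrightarrow> b' \<in> G \<Longrightarrow> a' + b' = a + b \<Longrightarrow> a' = a \<and> b' = b"
    using exists_unique_sum[of F G] by metis
  have uniq': "a' = a \<and> b' = b"
    if "a' \<in> Poly_Mapping.keys f" "b' \<in> Poly_Mapping.keys g" "a' + b' = a + b" for a' b'
  proof -
    have "deg_on A a' + deg_on A b' = deg_on A m0 + deg_on A n0"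
      using that(3) ab by (metis (mono_tags, lifting) F_def G_def deg_on_add mem_Collect_eq)
    with m0(3)[OF that(1)] n0(3)[OF that(2)] have "a' \<in> F" "b' \<in> G" using that by (auto simp: F_def G_def)
    with uniq that(3) show ?thesis by blast
  qed
  have "f * g = (\<Sum>a'\<in>Poly_Mapping.keys f. \<Sum>b'\<in>Poly_Mapping.keys g.
      Poly_Mapping.single (a' + b') (Poly_Mapping.lookup f a' * Poly_Mapping.lookup g b'))"
    by (subst (1) sum_of_monomials[symmetric, of f], subst (1) sum_of_monomials[symmetric, of g])
       (simp add: sum_product mult_single)
  then have "Poly_Mapping.lookup (f * g) (a + b) = (\<Sum>a'\<in>Poly_Mapping.keys f. \<Sum>b'\<in>Poly_Mapping.keys g.
      (Poly_Mapping.lookup f a' * Poly_Mapping.lookup g b' when a' + b' = a + b))"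
    by (simp add: lookup_sum lookup_single)
  also have "\<dots> = (\<Sum>a'\<in>Poly_Mapping.keys f. \<Sum>b'\<in>Poly_Mapping.keys g.
      if b' = b then (if a' = a then Poly_Mapping.lookup f a * Poly_Mapping.lookup g b else 0) else 0)"
    by (intro sum.cong refl) (use uniq' in \<open>auto simp: when_def\<close>)
  also have "\<dots> = Poly_Mapping.lookup f a * Poly_Mapping.lookup g b"
    using ab by (simp add: F_def G_def)
  also have "\<dots> \<noteq> 0" using ab by (simp add: F_def G_def in_keys_iff)
  finally have "a + b \<in> Poly_Mapping.keys (f * g)" by (simp add: in_keys_iff)
  moreover have "deg_on A (a + b) \<le> d + e" using ab m0 n0 by (auto simp: F_def G_def deg_on_add)
  ultimately show ?thesis by blast
qed

definition monomial_ideal :: "('v::finite \<Rightarrow>\<^sub>0 nat) set \<Rightarrow> ('v, 'k::field) mpolynomial set" where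
  "monomial_ideal M = {p. Poly_Mapping.keys p \<subseteq> M}"

lemma single_in_monomial_ideal_iff: "Poly_Mapping.single m c \<in> monomial_ideal M \<longleftrightarrow> c = 0 \<or> m \<in> M"
  by (simp add: monomial_ideal_def)

lemma ideal_monomial_ideal:
  assumes "\<And>m n. m \<in> M \<Longrightarrow> n + m \<in> M"
  shows "ideal (monomial_ideal M :: ('v::finite, 'k::field) mpolynomial set) mpoly_ring"
proof (rule ideal_type_algebraI)
  fix x y :: "('v, 'k) mpolynomial" assume "x \<in> monomial_ideal M" "y \<in> monomial_ideal M"
  then show "x + y \<in> monomial_ideal M" using Poly_Mapping.keys_add[of x y] by (auto simp: monomial_ideal_def)
next
  fix x r :: "('v, 'k) mpolynomial" assume "x \<in> monomial_ideal M"
  then show "r * x \<in> monomial_ideal M"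
    using keys_mult[of r x] assms by (fastforce simp: monomial_ideal_def)
qed (simp add: monomial_ideal_def)

lemma single_mult_in_monomial_ideal_iff:
  fixes p :: "('v::finite, 'k::field) mpolynomial"
  shows "p * Poly_Mapping.single n 1 \<in> monomial_ideal M \<longleftrightarrow> (\<forall>m\<in>Poly_Mapping.keys p. m + n \<in> M)"
proof -
  have eq: "p * Poly_Mapping.single n 1 = (\<Sum>m\<in>Poly_Mapping.keys p. Poly_Mapping.single (m + n) (Poly_Mapping.lookup p m))"
    by (subst (1) sum_of_monomials[symmetric, of p]) (simp add: sum_distrib_right mult_single)
  have "Poly_Mapping.lookup (p * Poly_Mapping.single n 1) (m + n) = Poly_Mapping.lookup p m" for m
    unfolding eq by (simp add: lookup_sum lookup_single when_def in_keys_iff)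
  then have "m \<in> Poly_Mapping.keys p \<longleftrightarrow> m + n \<in> Poly_Mapping.keys (p * Poly_Mapping.single n 1)" for m
    by (simp add: in_keys_iff)
  moreover have "Poly_Mapping.keys (p * Poly_Mapping.single n 1) \<subseteq> (\<lambda>m. m + n) ` Poly_Mapping.keys p"
    using keys_mult[of p "Poly_Mapping.single n 1"] by auto
  ultimately show ?thesis unfolding monomial_ideal_def by blast
qed

text \<open>An exponent has nonzero degree on \<open>A\<close> exactly if its monomial is divisible by a variable in \<open>A\<close>, so
  the ideal is the one generated by these variables.\<close>

lemma primeideal_vars:
  "primeideal (monomial_ideal {m. deg_on A m \<noteq> 0} :: ('v::finite, 'k::field) mpolynomial set) mpoly_ring"
proof (rule primeidealI)
  show "ideal (monomial_ideal {m. deg_on A m \<noteq> 0} :: ('v, 'k) mpolynomial set) mpoly_ring"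
    by (rule ideal_monomial_ideal) (simp add: deg_on_add)
  have "(1 :: ('v, 'k) mpolynomial) \<notin> monomial_ideal {m. deg_on A m \<noteq> 0}"
    by (simp add: monomial_ideal_def deg_on_def)
  then show "carrier mpoly_ring \<noteq> (monomial_ideal {m. deg_on A m \<noteq> 0} :: ('v, 'k) mpolynomial set)"
    by auto
  fix f g :: "('v, 'k) mpolynomial"
  assume fg: "f \<otimes>\<^bsub>mpoly_ring\<^esub> g \<in> monomial_ideal {m. deg_on A m \<noteq> 0}"
  show "f \<in> monomial_ideal {m. deg_on A m \<noteq> 0} \<or> g \<in> monomial_ideal {m. deg_on A m \<noteq> 0}"
  proof (rule ccontr)
    assume "\<not> ?thesis"
    then have "\<exists>m\<in>Poly_Mapping.keys f. deg_on A m \<le> 0" "\<exists>m\<in>Poly_Mapping.keys g. deg_on A m \<le> 0"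
      by (auto simp: monomial_ideal_def)
    from low_degree_exponent_of_product[OF this] show False using fg by (auto simp: monomial_ideal_def)
  qed
qed (rule cring_from_type_algebra)

lemma ideal_prod_monomial_ideal:
  assumes M: "\<And>m n. m \<in> M \<Longrightarrow> n + m \<in> M" and N: "\<And>m n. m \<in> N \<Longrightarrow> n + m \<in> N"
  shows "ideal_prod mpoly_ring (monomial_ideal M) (monomial_ideal N)
    = (monomial_ideal {m + n |m n. m \<in> M \<and> n \<in> N} :: ('v::finite, 'k::field) mpolynomial set)" (is "?L = ?R")
proof -
  interpret R: cring "mpoly_ring :: ('v, 'k) mpolynomial ring" by (rule cring_from_type_algebra)
  have idl: "ideal ?L (mpoly_ring :: ('v, 'k) mpolynomial ring)"
    by (rule R.ideal_prod_is_ideal) (use ideal_monomial_ideal M N in blast)+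
  show ?thesis
  proof (intro subset_antisym subsetI)
    fix p assume "p \<in> ?L"
    then show "p \<in> ?R"
    proof induction
      case (prod i j)
      have "Poly_Mapping.keys (i * j) \<subseteq> {m + n |m n. m \<in> Poly_Mapping.keys i \<and> n \<in> Poly_Mapping.keys j}"
        by (rule keys_mult)
      also have "\<dots> \<subseteq> {m + n |m n. m \<in> M \<and> n \<in> N}" using prod by (auto simp: monomial_ideal_def)
      finally show ?case by (simp add: monomial_ideal_def)
    next
      case (sum p q)
      then show ?case using Poly_Mapping.keys_add[of p q] by (auto simp: monomial_ideal_def)
    qed
  next
    fix p :: "('v, 'k) mpolynomial" assume p: "p \<in> ?R"
    have "Poly_Mapping.single m (Poly_Mapping.lookup p m) \<in> ?L" if m: "m \<in> Poly_Mapping.keys p" for m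
    proof -
      obtain a b where "m = a + b" "a \<in> M" "b \<in> N" using p m by (auto simp: monomial_ideal_def)
      moreover from this ideal_prod.prod[of "Poly_Mapping.single a (Poly_Mapping.lookup p m)" "monomial_ideal M" "Poly_Mapping.single b 1"
          "monomial_ideal N" "mpoly_ring :: ('v, 'k) mpolynomial ring"]
      have "Poly_Mapping.single a (Poly_Mapping.lookup p m) * Poly_Mapping.single b 1 \<in> ?L"
        by (simp add: single_in_monomial_ideal_iff)
      ultimately show ?thesis by (simp add: mult_single)
    qed
    then have "(\<Sum>m\<in>Poly_Mapping.keys p. Poly_Mapping.single m (Poly_Mapping.lookup p m)) \<in> ?L"
      by (rule ideal_type_algebra_sum[OF idl])
    then show "p \<in> ?L" by (simp add: sum_of_monomials)
  qed
qed

lemma edge_ideal_eq: "edge_ideal E = (monomial_ideal (edge_power_exponents E 1) :: ('v::finite, 'k::field) mpolynomial set)"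
proof -
  interpret R: cring "mpoly_ring :: ('v, 'k) mpolynomial ring" by (rule cring_from_type_algebra)
  let ?S = "{var i * var j |i j. {i, j} \<in> E} :: ('v, 'k) mpolynomial set"
  have vv: "var i * var j = (Poly_Mapping.single (Poly_Mapping.single i 1 + Poly_Mapping.single j 1) 1 :: ('v, 'k) mpolynomial)" for i j
    by (simp add: var_def mult_single)
  have idl: "ideal (edge_ideal E :: ('v, 'k) mpolynomial set) mpoly_ring"
    unfolding edge_ideal_def by (rule R.genideal_ideal) simp
  have S: "?S \<subseteq> edge_ideal E" unfolding edge_ideal_def by (rule R.genideal_self) simp
  show ?thesis
  proof (intro subset_antisym subsetI)
    have "edge_ideal E \<subseteq> (monomial_ideal (edge_power_exponents E 1) :: ('v, 'k) mpolynomial set)"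
      unfolding edge_ideal_def
    proof (rule R.genideal_minimal)
      show "ideal (monomial_ideal (edge_power_exponents E 1) :: ('v, 'k) mpolynomial set) mpoly_ring"
        by (rule ideal_monomial_ideal) (metis add.commute edge_power_exponents_upward)
      show "?S \<subseteq> monomial_ideal (edge_power_exponents E 1)"
        by (auto simp: vv single_in_monomial_ideal_iff) (metis add.left_neutral)
    qed
    then show "p \<in> edge_ideal E \<Longrightarrow> p \<in> monomial_ideal (edge_power_exponents E 1)" for p :: "('v, 'k) mpolynomial" by blast
  next
    fix p :: "('v, 'k) mpolynomial" assume p: "p \<in> monomial_ideal (edge_power_exponents E 1)"
    have "Poly_Mapping.single m (Poly_Mapping.lookup p m) \<in> edge_ideal E" if "m \<in> Poly_Mapping.keys p" for m
    proof -
      have "m \<in> edge_power_exponents E 1" using p that by (auto simp: monomial_ideal_def)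
      then obtain n i j where n: "m = n + (Poly_Mapping.single i 1 + Poly_Mapping.single j 1)" "{i, j} \<in> E" by auto
      then have "var i * var j \<in> (edge_ideal E :: ('v, 'k) mpolynomial set)" using S by blast
      from ideal_type_algebraD(3)[OF idl this, of "Poly_Mapping.single n (Poly_Mapping.lookup p m)"]
      show ?thesis unfolding vv by (simp add: mult_single n(1))
    qed
    then have "(\<Sum>m\<in>Poly_Mapping.keys p. Poly_Mapping.single m (Poly_Mapping.lookup p m)) \<in> edge_ideal E"
      by (rule ideal_type_algebra_sum[OF idl])
    then show "p \<in> edge_ideal E" by (simp add: sum_of_monomials)
  qed
qed

lemma ideal_edge_power: "ideal (monomial_ideal (edge_power_exponents E t) :: ('v::finite, 'k::field) mpolynomial set) mpoly_ring"
  by (rule ideal_monomial_ideal) (metis add.commute edge_power_exponents_upward)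

lemma ideal_power_edge_ideal:
  "ideal_power mpoly_ring (edge_ideal E) t = (monomial_ideal (edge_power_exponents E t) :: ('v::finite, 'k::field) mpolynomial set)"
proof (induction t)
  case 0
  show ?case by (simp add: ideal_power_def nat_pow_0 ideals_set_def monomial_ideal_def)
next
  case (Suc t)
  interpret R: cring "mpoly_ring :: ('v, 'k) mpolynomial ring" by (rule cring_from_type_algebra)
  interpret I: comm_monoid "ideals_set (mpoly_ring :: ('v, 'k) mpolynomial ring)" by (rule R.ideals_set_is_comm_monoid)
  have up: "\<And>m n. m \<in> edge_power_exponents E k \<Longrightarrow> n + m \<in> edge_power_exponents E k" for k
    by (metis add.commute edge_power_exponents_upward)
  have "ideal_power mpoly_ring (edge_ideal E :: ('v, 'k) mpolynomial set) (Suc t)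
    = ideal_prod mpoly_ring (ideal_power mpoly_ring (edge_ideal E) t) (edge_ideal E)"
    by (simp add: ideal_power_def) (simp add: ideals_set_def)
  also have "\<dots> = monomial_ideal {m + n |m n. m \<in> edge_power_exponents E t \<and> n \<in> edge_power_exponents E 1}"
    unfolding Suc.IH unfolding edge_ideal_eq by (rule ideal_prod_monomial_ideal) (rule up, assumption)+
  also have "{m + n |m n. m \<in> edge_power_exponents E t \<and> n \<in> edge_power_exponents E 1} = edge_power_exponents E (Suc t)" (is "?A = ?B")
  proof (intro subset_antisym subsetI)
    fix x assume "x \<in> ?A"
    then obtain m n u v where "x = m + (n + (Poly_Mapping.single u 1 + Poly_Mapping.single v 1))" "m \<in> edge_power_exponents E t" "{u, v} \<in> E"
      by auto
    then have "x = (m + n) + (Poly_Mapping.single u 1 + Poly_Mapping.single v 1)" "m + n \<in> edge_power_exponents E t"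
      by (simp_all add: ac_simps edge_power_exponents_upward)
    with \<open>{u, v} \<in> E\<close> show "x \<in> ?B" by auto
  next
    fix x assume "x \<in> ?B"
    then obtain m u v where x: "x = m + (Poly_Mapping.single u 1 + Poly_Mapping.single v 1)" "m \<in> edge_power_exponents E t" "{u, v} \<in> E"
      by auto
    moreover have "0 + (Poly_Mapping.single u 1 + Poly_Mapping.single v 1) \<in> edge_power_exponents E 1"
      using edge_power_exponents_single_edge[OF x(3), of 0 1] .
    ultimately show "x \<in> ?A" by (metis (mono_tags, lifting) add_0 mem_Collect_eq)
  qed
  finally show ?case .
qed

section \<open>Chains of primes in the polynomial ring\<close>

text \<open>Stated for families instead of sets, so that repeated values count as a relation.\<close>

lemma (in vector_space) exists_linear_relation:
  assumes "finite T" and J: "finite J" and card: "card T < card J" and span: "g ` J \<subseteq> span T"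
  shows "\<exists>c. (\<exists>j\<in>J. c j \<noteq> 0) \<and> (\<Sum>j\<in>J. scale (c j) (g j)) = 0"
proof (cases "inj_on g J")
  case True
  have "dependent (g ` J)"
    using independent_span_bound[OF \<open>finite T\<close> _ span] card card_image[OF True] by auto
  then obtain u where u: "\<exists>v\<in>g ` J. u v \<noteq> 0" "(\<Sum>v\<in>g ` J. scale (u v) v) = 0"
    using J dependent_finite[of "g ` J"] by auto
  have "(\<Sum>j\<in>J. scale (u (g j)) (g j)) = 0"
    using u(2) sum.reindex[OF True, of "\<lambda>v. scale (u v) v"] by simp
  with u(1) show ?thesis by (intro exI[of _ "\<lambda>j. u (g j)"]) auto
next
  case False
  then obtain i j where ij: "i \<in> J" "j \<in> J" "i \<noteq> j" "g i = g j" by (auto simp: inj_on_def)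
  define c :: "_ \<Rightarrow> 'a" where "c x = (if x = i then 1 else if x = j then - 1 else 0)" for x
  have "(\<Sum>x\<in>J. scale (c x) (g x)) = (\<Sum>x\<in>{i, j}. scale (c x) (g x))"
    using ij J by (intro sum.mono_neutral_right) (auto simp: c_def)
  also have "\<dots> = 0" using ij by (simp add: c_def)
  finally show ?thesis using ij by (intro exI[of _ c]) (auto simp: c_def)
qed

lemma vector_space_mpolynomial:
  "vector_space (\<lambda>(a::'k::field) (p::('v::finite, 'k) mpolynomial). Poly_Mapping.single 0 a * p)"
  by unfold_locales (simp_all add: algebra_simps single_add mult_single flip: mult.assoc)

text \<open>The degree in each single variable is bounded, which makes the number of admissible monomials in
  \<open>n\<close> variables a plain power \<open>(k + 1) ^ n\<close>.\<close>

definition exponents_le :: "nat \<Rightarrow> ('v::finite, 'k::field) mpolynomial \<Rightarrow> bool" where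
  "exponents_le k p \<longleftrightarrow> (\<forall>m\<in>Poly_Mapping.keys p. \<forall>v. Poly_Mapping.lookup m v \<le> k)"

lemma exponents_le_mult: "exponents_le k p \<Longrightarrow> exponents_le l q \<Longrightarrow> exponents_le (k + l) (p * q)"
  using keys_mult[of p q] unfolding exponents_le_def
  by (fastforce simp: lookup_add intro: add_mono)

lemma exponents_le_power: "exponents_le k p \<Longrightarrow> exponents_le (r * k) (p ^ r)"
proof (induction r)
  case (Suc r)
  then show ?case using exponents_le_mult[of k p "r * k" "p ^ r"] by simp
qed (simp add: exponents_le_def)

lemma exponents_le_weaken: "exponents_le k p \<Longrightarrow> k \<le> l \<Longrightarrow> exponents_le l p"
  unfolding exponents_le_def by (meson order.trans)

lemma exponents_le_exists:
  fixes p :: "('v::finite, 'k::field) mpolynomial"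
  shows "\<exists>k. exponents_le k p"
proof -
  have "Poly_Mapping.lookup m v \<le> (\<Sum>m\<in>Poly_Mapping.keys p. deg_on UNIV m)" if "m \<in> Poly_Mapping.keys p" for m v
  proof -
    have "Poly_Mapping.lookup m v \<le> deg_on UNIV m" unfolding deg_on_def by (rule member_le_sum) auto
    also have "\<dots> \<le> (\<Sum>m\<in>Poly_Mapping.keys p. deg_on UNIV m)" using that by (intro member_le_sum) auto
    finally show ?thesis .
  qed
  then show ?thesis unfolding exponents_le_def by blast
qed

text \<open>Elements \<open>a i\<close> picked from the successive differences of a chain of primes are algebraically
  independent modulo its first member; the family consists of the monomials in the last \<open>k\<close> of them with
  all exponents at most \<open>D\<close>, each encoded by its list of exponents. The proof goes down the chain. A
  relation modulo \<open>P j\<close> is a polynomial in \<open>a j\<close> with coefficients \<open>T r\<close> in the later elements. Dividing by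
  the lowest power of \<open>a j\<close>, which is possible because \<open>a j\<close> is not in the prime \<open>P j\<close>, and passing to
  \<open>P (Suc j)\<close>, which contains \<open>a j\<close>, leaves the lowest coefficient as a relation between the later
  elements.\<close>

lemma prime_chain_independent_family:
  fixes P :: "nat \<Rightarrow> ('v::finite, 'k::field) mpolynomial set"
  assumes prime: "\<And>i. i \<le> n \<Longrightarrow> primeideal (P i) mpoly_ring"
    and chain: "\<And>i. i < n \<Longrightarrow> P i \<subseteq> P (Suc i)"
    and a: "\<And>i. i < n \<Longrightarrow> a i \<in> P (Suc i)" "\<And>i. i < n \<Longrightarrow> a i \<notin> P i"
    and d: "\<And>i. i < n \<Longrightarrow> exponents_le d (a i)"
  shows "k \<le> n \<Longrightarrow> \<exists>S (f :: nat list \<Rightarrow> ('v, 'k) mpolynomial). finite S \<and> card S = (D + 1) ^ k \<and>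
    (\<forall>e\<in>S. exponents_le (k * (D * d)) (f e)) \<and>
    (\<forall>c. (\<Sum>e\<in>S. Poly_Mapping.single 0 (c e) * f e) \<in> P (n - k) \<longrightarrow> (\<forall>e\<in>S. c e = 0))"
proof (induction k)
  case 0
  have "c = 0" if "Poly_Mapping.single 0 c \<in> P n" for c
  proof (rule ccontr)
    assume "c \<noteq> 0"
    then have "Poly_Mapping.single 0 (1 / c) * Poly_Mapping.single (0 :: 'v \<Rightarrow>\<^sub>0 nat) c = 1"
      by (simp add: mult_single)
    then show False
      using that primeideal_type_algebraD(1,2)[OF prime[of n]] ideal_type_algebraD(3) by (metis order.refl)
  qed
  then show ?case
    by (intro exI[of _ "{[]}"] exI[of _ "\<lambda>_. 1"]) (simp add: exponents_le_def)
next
  case (Suc k)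
  then obtain S and f :: "nat list \<Rightarrow> ('v, 'k) mpolynomial" where S: "finite S" "card S = (D + 1) ^ k"
    and f: "\<And>e. e \<in> S \<Longrightarrow> exponents_le (k * (D * d)) (f e)"
    and ind: "\<And>c. (\<Sum>e\<in>S. Poly_Mapping.single 0 (c e) * f e) \<in> P (n - k) \<Longrightarrow> \<forall>e\<in>S. c e = 0"
    by auto
  define j where "j = n - Suc k"
  have j: "j < n" "n - k = Suc j" using Suc.prems by (auto simp: j_def)
  have primej: "primeideal (P j) mpoly_ring" and primeSj: "primeideal (P (Suc j)) mpoly_ring"
    using prime j(1) by auto
  note Pj = primeideal_type_algebraD[OF primej] and Qj = primeideal_type_algebraD[OF primeSj]
  define S' where "S' = (\<lambda>(r, e). r # e) ` ({..D} \<times> S)"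
  define f' where "f' l = a j ^ hd l * f (tl l)" for l
  have inj: "inj_on (\<lambda>(r, e). r # e) ({..D} \<times> S)" by (auto simp: inj_on_def)
  have "finite S'" using S by (simp add: S'_def)
  moreover have "card S' = (D + 1) ^ Suc k"
    using S by (simp add: S'_def card_image[OF inj] card_cartesian_product)
  moreover have "exponents_le (Suc k * (D * d)) (f' e)" if e: "e \<in> S'" for e
  proof -
    obtain r e' where re: "r \<le> D" "e' \<in> S" "e = r # e'" using e by (auto simp: S'_def)
    have "exponents_le (r * d + k * (D * d)) (f' e)"
      using exponents_le_mult[OF exponents_le_power[OF d[OF j(1)]] f[OF re(2)], of r] by (simp add: f'_def re)
    then show ?thesis by (rule exponents_le_weaken) (use re in simp)
  qed
  moreover have "c e = 0" if c: "(\<Sum>e\<in>S'. Poly_Mapping.single 0 (c e) * f' e) \<in> P j" and e: "e \<in> S'" for c e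
  proof -
    define T where "T r = (\<Sum>e\<in>S. Poly_Mapping.single 0 (c (r # e)) * f e)" for r
    have "(\<Sum>e\<in>S'. Poly_Mapping.single 0 (c e) * f' e) = (\<Sum>r\<le>D. a j ^ r * T r)"
      unfolding S'_def sum.reindex[OF inj] T_def sum_distrib_left sum.cartesian_product
      by (intro sum.cong refl) (auto simp: f'_def ac_simps)
    with c have sumT: "(\<Sum>r\<le>D. a j ^ r * T r) \<in> P j" by simp
    have "r \<le> D \<longrightarrow> (\<forall>e\<in>S. c (r # e) = 0)" for r
    proof (induction r rule: less_induct)
      case (less r)
      show ?case
      proof
        assume r: "r \<le> D"
        have T0: "T i = 0" if "i < r" for i using less.IH[OF that] that r by (simp add: T_def)
        have "(\<Sum>i\<le>D. a j ^ i * T i) = (\<Sum>i\<in>{r..D}. a j ^ i * T i)"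
          by (intro sum.mono_neutral_right) (auto simp: T0)
        also have "\<dots> = a j ^ r * (\<Sum>i\<in>{r..D}. a j ^ (i - r) * T i)"
          unfolding sum_distrib_left by (intro sum.cong refl) (simp flip: mult.assoc power_add)
        finally have "a j ^ r * (\<Sum>i\<in>{r..D}. a j ^ (i - r) * T i) \<in> P j" using sumT by simp
        moreover have "a j ^ r \<notin> P j" using primeideal_type_algebra_power[OF primej] a(2)[OF j(1)] by blast
        ultimately have "(\<Sum>i\<in>{r..D}. a j ^ (i - r) * T i) \<in> P j" using Pj(3) by blast
        then have "(\<Sum>i\<in>{r..D}. a j ^ (i - r) * T i) \<in> P (Suc j)" using chain[OF j(1)] by blast
        also have "(\<Sum>i\<in>{r..D}. a j ^ (i - r) * T i) = T r + (\<Sum>i\<in>{Suc r..D}. a j ^ (i - r) * T i)"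
          using r by (simp add: sum.atLeast_Suc_atMost)
        finally have "T r + (\<Sum>i\<in>{Suc r..D}. a j ^ (i - r) * T i) \<in> P (Suc j)" .
        moreover have "(\<Sum>i\<in>{Suc r..D}. a j ^ (i - r) * T i) \<in> P (Suc j)"
        proof (rule ideal_type_algebra_sum[OF Qj(1)])
          fix i assume "i \<in> {Suc r..D}"
          then have "i - r = Suc (i - Suc r)" by (simp add: Suc_diff_Suc)
          then have "a j ^ (i - r) * T i = (a j ^ (i - Suc r) * T i) * a j" by (simp only: power_Suc ac_simps)
          then show "a j ^ (i - r) * T i \<in> P (Suc j)"
            using ideal_type_algebraD(3)[OF Qj(1) a(1)[OF j(1)]] by simp
        qed
        ultimately have "T r \<in> P (Suc j)" using ideal_type_algebraD(4)[OF Qj(1)] by fastforce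
        then show "\<forall>e\<in>S. c (r # e) = 0" using ind[of "\<lambda>e. c (r # e)"] by (simp add: T_def j)
      qed
    qed
    then show ?thesis using e by (auto simp: S'_def)
  qed
  ultimately show ?case unfolding j_def[symmetric] by (intro exI[of _ S'] exI[of _ f']) blast
qed

text \<open>Drop all monomials that involve a variable of \<open>P\<close>.\<close>

lemma reduce_modulo_variables:
  fixes p :: "('v::finite, 'k::field) mpolynomial"
  assumes P: "ideal P mpoly_ring" and K: "exponents_le K p"
  shows "\<exists>q\<in>module.span (\<lambda>a p. Poly_Mapping.single 0 a * p)
      ((\<lambda>m. Poly_Mapping.single m 1) ` {m. (\<forall>v. Poly_Mapping.lookup m v \<le> K) \<and> (\<forall>v. var v \<in> P \<longrightarrow> Poly_Mapping.lookup m v = 0)}).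
      p - q \<in> P"
proof -
  interpret vs: vector_space "\<lambda>(a::'k) (p::('v, 'k) mpolynomial). Poly_Mapping.single 0 a * p"
    by (rule vector_space_mpolynomial)
  define M where "M = {m. (\<forall>v. Poly_Mapping.lookup m v \<le> K) \<and> (\<forall>v. (var v :: ('v, 'k) mpolynomial) \<in> P \<longrightarrow> Poly_Mapping.lookup m v = 0)}"
  let ?t = "\<lambda>m. Poly_Mapping.single m (Poly_Mapping.lookup p m)"
  define q where "q = (\<Sum>m\<in>Poly_Mapping.keys p \<inter> M. ?t m)"
  have "q \<in> vs.span ((\<lambda>m. Poly_Mapping.single m 1) ` M)"
    unfolding q_def
  proof (rule vs.span_sum)
    fix m assume "m \<in> Poly_Mapping.keys p \<inter> M"
    then have "Poly_Mapping.single 0 (Poly_Mapping.lookup p m) * Poly_Mapping.single m 1 \<in> vs.span ((\<lambda>m. Poly_Mapping.single m 1) ` M)"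
      by (intro vs.span_scale vs.span_base) auto
    then show "?t m \<in> vs.span ((\<lambda>m. Poly_Mapping.single m 1) ` M)" by (simp add: mult_single)
  qed
  moreover have "p - q \<in> P"
  proof -
    have "(\<Sum>m\<in>Poly_Mapping.keys p. ?t m) = q + (\<Sum>m\<in>Poly_Mapping.keys p - M. ?t m)"
      unfolding q_def by (rule sum.Int_Diff) simp
    then have "p - q = (\<Sum>m\<in>Poly_Mapping.keys p - M. ?t m)" unfolding sum_of_monomials
      by (metis add_diff_cancel_left')
    also have "\<dots> \<in> P"
    proof (rule ideal_type_algebra_sum[OF P])
      fix m assume m: "m \<in> Poly_Mapping.keys p - M"
      then obtain v where v: "(var v :: ('v, 'k) mpolynomial) \<in> P" "Poly_Mapping.lookup m v \<noteq> 0"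
        using K by (auto simp: M_def exponents_le_def)
      have "m = (m - Poly_Mapping.single v 1) + Poly_Mapping.single v 1"
        using v(2) by (intro poly_mapping_eqI) (auto simp: lookup_add lookup_minus lookup_single when_def)
      then have "?t m = Poly_Mapping.single (m - Poly_Mapping.single v 1) (Poly_Mapping.lookup p m) * var v"
        by (simp add: var_def mult_single)
      then show "?t m \<in> P" using ideal_type_algebraD(3)[OF P v(1)] by simp
    qed
    finally show ?thesis .
  qed
  ultimately show ?thesis unfolding M_def by blast
qed

lemma card_bounded_exponents:
  fixes F :: "'v::finite set"
  shows "finite {m. (\<forall>v. Poly_Mapping.lookup m v \<le> K) \<and> (\<forall>v. v \<notin> F \<longrightarrow> Poly_Mapping.lookup m v = 0)}"
    and "card {m. (\<forall>v. Poly_Mapping.lookup m v \<le> K) \<and> (\<forall>v. v \<notin> F \<longrightarrow> Poly_Mapping.lookup m v = 0)} \<le> (K + 1) ^ card F"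
proof -
  define M where "M = {m. (\<forall>v. Poly_Mapping.lookup m v \<le> K) \<and> (\<forall>v. v \<notin> F \<longrightarrow> Poly_Mapping.lookup m v = 0)}"
  have inj: "inj_on (\<lambda>m. restrict (Poly_Mapping.lookup m) F) M"
  proof (rule inj_onI)
    fix m n assume mn: "m \<in> M" "n \<in> M" "restrict (Poly_Mapping.lookup m) F = restrict (Poly_Mapping.lookup n) F"
    show "m = n"
    proof (rule poly_mapping_eqI)
      fix v
      show "Poly_Mapping.lookup m v = Poly_Mapping.lookup n v"
        using mn(1,2) fun_cong[OF mn(3), of v] by (cases "v \<in> F") (auto simp: M_def)
    qed
  qed
  have sub: "(\<lambda>m. restrict (Poly_Mapping.lookup m) F) ` M \<subseteq> PiE F (\<lambda>_. {..K})"
    by (auto simp: M_def)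
  have fin: "finite (PiE F (\<lambda>_. {..K}))" by (intro finite_PiE) auto
  show "finite {m. (\<forall>v. Poly_Mapping.lookup m v \<le> K) \<and> (\<forall>v. v \<notin> F \<longrightarrow> Poly_Mapping.lookup m v = 0)}"
    using inj_on_finite[OF inj sub fin] unfolding M_def .
  show "card {m. (\<forall>v. Poly_Mapping.lookup m v \<le> K) \<and> (\<forall>v. v \<notin> F \<longrightarrow> Poly_Mapping.lookup m v = 0)} \<le> (K + 1) ^ card F"
    using card_inj_on_le[OF inj sub fin] unfolding M_def[symmetric] by (simp add: card_PiE)
qed

text \<open>If the chain were longer than the number of variables outside \<open>P 0\<close>, then the \<open>(D + 1) ^ n\<close>
  monomials in the chosen elements would be linearly independent modulo \<open>P 0\<close>, although modulo \<open>P 0\<close>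
  they lie in a space spanned by \<open>(n * (D * d) + 1) ^ card F\<close> monomials. As \<open>card F < n\<close>, this
  number is smaller once \<open>D\<close> is large.\<close>

lemma prime_chain_length_le:
  fixes P :: "nat \<Rightarrow> ('v::finite, 'k::field) mpolynomial set"
  assumes prime: "\<And>i. i \<le> n \<Longrightarrow> primeideal (P i) mpoly_ring"
    and chain: "\<And>i. i < n \<Longrightarrow> P i \<subset> P (Suc i)"
  shows "n \<le> card {v. var v \<notin> P 0}"
proof (rule ccontr)
  interpret vs: vector_space "\<lambda>(a::'k) (p::('v, 'k) mpolynomial). Poly_Mapping.single 0 a * p"
    by (rule vector_space_mpolynomial)
  define F where "F = {v. (var v :: ('v, 'k) mpolynomial) \<notin> P 0}"
  assume "\<not> n \<le> card {v. var v \<notin> P 0}"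
  then have less: "card F < n" by (simp add: F_def)
  have P0: "ideal (P 0) mpoly_ring" using primeideal_type_algebraD(1)[OF prime[of 0]] by simp
  have "\<exists>a. a \<in> P (Suc i) \<and> a \<notin> P i" if "i < n" for i using chain[OF that] by blast
  then obtain a where a: "\<And>i. i < n \<Longrightarrow> a i \<in> P (Suc i)" "\<And>i. i < n \<Longrightarrow> a i \<notin> P i" by metis
  have "\<forall>i. \<exists>k. exponents_le k (a i)" by (intro allI exponents_le_exists)
  then obtain dd where dd: "\<And>i. exponents_le (dd i) (a i)" by metis
  define d where "d = (\<Sum>i<n. dd i)"
  have d: "exponents_le d (a i)" if "i < n" for i
    by (rule exponents_le_weaken[OF dd]) (use that in \<open>auto simp: d_def intro: member_le_sum\<close>)
  \<comment> \<open>The span has dimension at most \<open>((n * d + 1) * (D + 1)) ^ card F\<close>, so any \<open>D\<close> not below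
    \<open>(n * d + 1) ^ card F\<close> makes it smaller than \<open>(D + 1) ^ n\<close>.\<close>
  define D where "D = (n * d + 1) ^ n"
  define K where "K = n * (D * d)"
  define M where "M = {m. (\<forall>v. Poly_Mapping.lookup m v \<le> K) \<and> (\<forall>v. v \<notin> F \<longrightarrow> Poly_Mapping.lookup m v = 0)}"
  have M: "finite M" "card M \<le> (K + 1) ^ card F"
    unfolding M_def by (rule card_bounded_exponents)+
  have chain': "\<And>i. i < n \<Longrightarrow> P i \<subseteq> P (Suc i)" using chain by blast
  obtain S :: "nat list set" and f where S: "finite S" "card S = (D + 1) ^ n"
    and f: "\<And>e. e \<in> S \<Longrightarrow> exponents_le K (f e)"
    and ind: "\<And>c. (\<Sum>e\<in>S. Poly_Mapping.single 0 (c e) * f e) \<in> P 0 \<Longrightarrow> \<forall>e\<in>S. c e = 0"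
    using prime_chain_independent_family[where P = P and a = a and n = n and k = n and d = d and D = D,
        OF prime chain' a d order.refl]
    unfolding K_def diff_self_eq_0 by blast
  let ?T = "(\<lambda>m. Poly_Mapping.single m 1) ` M :: ('v, 'k) mpolynomial set"
  have "\<exists>q\<in>vs.span ?T. f e - q \<in> P 0" if "e \<in> S" for e
    using reduce_modulo_variables[OF P0 f[OF that]] unfolding M_def F_def by simp
  then obtain g where g: "\<And>e. e \<in> S \<Longrightarrow> g e \<in> vs.span ?T" "\<And>e. e \<in> S \<Longrightarrow> f e - g e \<in> P 0" by metis
  have "card ?T \<le> (K + 1) ^ card F" using card_image_le[OF M(1)] M(2) by (rule order.trans)
  also have "\<dots> \<le> ((n * d + 1) * (D + 1)) ^ card F" by (intro power_mono) (simp_all add: K_def algebra_simps)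
  also have "\<dots> = (n * d + 1) ^ card F * (D + 1) ^ card F" by (rule power_mult_distrib)
  also have "\<dots> \<le> D * (D + 1) ^ card F"
    unfolding D_def using less by (intro mult_right_mono power_increasing) auto
  also have "\<dots> < (D + 1) ^ Suc (card F)" by simp
  also have "\<dots> \<le> (D + 1) ^ n" using less by (intro power_increasing) auto
  finally have "card ?T < card S" using S by simp
  then obtain c where c: "\<exists>e\<in>S. c e \<noteq> 0" "(\<Sum>e\<in>S. Poly_Mapping.single 0 (c e) * g e) = 0"
    using vs.exists_linear_relation[of ?T S g] S M g(1) by blast
  have "(\<Sum>e\<in>S. Poly_Mapping.single 0 (c e) * f e) = (\<Sum>e\<in>S. Poly_Mapping.single 0 (c e) * (f e - g e))"
    using c(2) by (simp add: right_diff_distrib sum_subtractf)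
  also have "\<dots> \<in> P 0"
    by (rule ideal_type_algebra_sum[OF P0]) (use ideal_type_algebraD(3)[OF P0] g(2) in blast)
  finally show False using ind c(1) by blast
qed

section \<open>Symbolic powers of edge ideals\<close>

lemma edge_exponents_iff:
  fixes E :: "'v::finite set set"
  assumes "simple_graph E"
  shows "m \<in> edge_power_exponents E 1 \<longleftrightarrow>
    (\<exists>u v. {u, v} \<in> E \<and> u \<in> Poly_Mapping.keys m \<and> v \<in> Poly_Mapping.keys m)"
proof
  assume "m \<in> edge_power_exponents E 1"
  then obtain n u v where "m = n + (Poly_Mapping.single u 1 + Poly_Mapping.single v 1)" "{u, v} \<in> E" by auto
  then show "\<exists>u v. {u, v} \<in> E \<and> u \<in> Poly_Mapping.keys m \<and> v \<in> Poly_Mapping.keys m"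
    by (intro exI[of _ u] exI[of _ v]) (auto simp: in_keys_iff lookup_add lookup_single)
next
  assume "\<exists>u v. {u, v} \<in> E \<and> u \<in> Poly_Mapping.keys m \<and> v \<in> Poly_Mapping.keys m"
  then obtain u v where uv: "{u, v} \<in> E" "u \<in> Poly_Mapping.keys m" "v \<in> Poly_Mapping.keys m" by blast
  then have "u \<noteq> v" using assms by (auto simp: simple_graph_def)
  with uv have "m = (m - (Poly_Mapping.single u 1 + Poly_Mapping.single v 1)) + (Poly_Mapping.single u 1 + Poly_Mapping.single v 1)"
    by (intro poly_mapping_eqI) (auto simp: in_keys_iff lookup_add lookup_minus lookup_single when_def)
  then show "m \<in> edge_power_exponents E 1"
    using edge_power_exponents_single_edge[OF uv(1), of "m - (Poly_Mapping.single u 1 + Poly_Mapping.single v 1)" 1] by simp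
qed

lemma deg_on_cover_edge_power:
  fixes E :: "'v::finite set set"
  assumes A: "vertex_cover E A"
  shows "m \<in> edge_power_exponents E t \<Longrightarrow> t \<le> deg_on A m"
proof (induction t arbitrary: m)
  case (Suc t)
  then obtain m' u v where m: "m = m' + (Poly_Mapping.single u 1 + Poly_Mapping.single v 1)"
    "m' \<in> edge_power_exponents E t" "{u, v} \<in> E" by auto
  have "{u, v} \<inter> A \<noteq> {}" using A m(3) unfolding vertex_cover_def by blast
  with Suc.IH[OF m(2)] show ?case by (auto simp: m deg_on_add deg_on_single)
qed simp

text \<open>For a simple graph these are the vertex covers that are minimal under inclusion, in a form that provides the neighbour
  needed to complete a vertex to an edge.\<close>

definition irredundant_cover :: "'v set set \<Rightarrow> 'v set \<Rightarrow> bool" where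
  "irredundant_cover E A \<longleftrightarrow> vertex_cover E A \<and> (\<forall>u\<in>A. \<exists>v. v \<notin> A \<and> {u, v} \<in> E)"

lemma irredundant_subcover:
  fixes E :: "'v::finite set set"
  assumes "simple_graph E" and "vertex_cover E A"
  shows "\<exists>B\<subseteq>A. irredundant_cover E B"
  using finite[of A] assms(2)
proof (induction A rule: finite_psubset_induct)
  case (psubset A)
  show ?case
  proof (cases "irredundant_cover E A")
    case False
    then obtain u where u: "u \<in> A" "\<And>v. {u, v} \<in> E \<Longrightarrow> v \<in> A"
      using psubset.prems by (auto simp: irredundant_cover_def)
    have "vertex_cover E (A - {u})"
      unfolding vertex_cover_def
    proof
      fix e assume e: "e \<in> E"
      show "e \<inter> (A - {u}) \<noteq> {}"
      proof (cases "u \<in> e")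
        case True
        with e assms(1) obtain v where "e = {u, v}" "v \<noteq> u"
          unfolding simple_graph_def card_2_iff by (metis doubleton_eq_iff insertE singletonD)
        with u(2) e show ?thesis by auto
      next
        case False
        have "e \<inter> A \<noteq> {}" using psubset.prems e by (simp add: vertex_cover_def)
        with False show ?thesis by auto
      qed
    qed
    moreover have "A - {u} \<subset> A" using u(1) by blast
    ultimately obtain B where "B \<subseteq> A - {u}" "irredundant_cover E B" using psubset.IH by blast
    then show ?thesis by blast
  qed blast
qed

lemma var_power: "var v ^ t = Poly_Mapping.single (Poly_Mapping.single v t) 1"
  by (induction t) (simp_all add: var_def mult_single flip: single_add)

lemma monomial_notin_prime:
  fixes P :: "('v::finite, 'k::field) mpolynomial set"
  assumes P: "primeideal P mpoly_ring" and B: "\<And>v. v \<in> B \<Longrightarrow> var v \<notin> P"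
  shows "Poly_Mapping.single (\<Sum>v\<in>B. Poly_Mapping.single v t) 1 \<notin> P"
  using finite[of B] B
proof (induction B rule: finite_induct)
  case empty
  then show ?case using primeideal_type_algebraD(2)[OF P] by simp
next
  case (insert v B)
  have "(Poly_Mapping.single (\<Sum>v\<in>insert v B. Poly_Mapping.single v t) 1 :: ('v, 'k) mpolynomial)
    = var v ^ t * Poly_Mapping.single (\<Sum>v\<in>B. Poly_Mapping.single v t) 1"
    using insert.hyps by (simp add: var_power mult_single)
  moreover have "var v ^ t \<notin> P" using primeideal_type_algebra_power[OF P] insert.prems by blast
  moreover have "Poly_Mapping.single (\<Sum>v\<in>B. Poly_Mapping.single v t) 1 \<notin> P" using insert by blast
  ultimately show ?case using primeideal_type_algebraD(3)[OF P] by metis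
qed

lemma lookup_sum_single:
  fixes B :: "'v::finite set"
  shows "Poly_Mapping.lookup (\<Sum>v\<in>B. Poly_Mapping.single v k) u = (if u \<in> B then k else 0)"
  by (simp add: lookup_sum lookup_single when_def)

lemma associated_primes_edge_ideal:
  fixes E :: "'v::finite set set"
  shows "associated_primes mpoly_ring (quotient_module mpoly_ring (carrier mpoly_ring) (edge_ideal E))
    = {P :: ('v, 'k::field) mpolynomial set. primeideal P mpoly_ring \<and>
        (\<exists>y. P = {r. r * y \<in> monomial_ideal (edge_power_exponents E 1)})}"
  unfolding edge_ideal_eq cring.associated_primes_quotient_ring[OF cring_from_type_algebra ideal_edge_power]
  by simp

text \<open>Let \<open>P\<close> be the annihilator of the class of \<open>y\<close>, and let \<open>m\<close> be an exponent of \<open>y\<close> that contains no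
  edge. If \<open>x_u y\<close> lies in the edge ideal then \<open>m\<close> together with \<open>u\<close> contains an edge, so \<open>u\<close> has a
  neighbour \<open>b\<close> in the support of \<open>m\<close>. If \<open>x_b\<close> were in \<open>P\<close> too, the same argument would give an edge inside
  the support of \<open>m\<close>.\<close>

lemma associated_prime_irredundant_cover:
  fixes P :: "('v::finite, 'k::field) mpolynomial set"
  assumes simple: "simple_graph E"
    and "P \<in> associated_primes mpoly_ring (quotient_module mpoly_ring (carrier mpoly_ring) (edge_ideal E))"
  shows "irredundant_cover E {v. var v \<in> P}"
proof -
  from assms(2) obtain y where P: "primeideal P mpoly_ring"
    and y: "P = {r. r * y \<in> monomial_ideal (edge_power_exponents E 1)}"
    unfolding associated_primes_edge_ideal by blast
  have "y \<notin> monomial_ideal (edge_power_exponents E 1)" using primeideal_type_algebraD(2)[OF P] y by auto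
  then obtain m where m: "m \<in> Poly_Mapping.keys y" "m \<notin> edge_power_exponents E 1"
    unfolding monomial_ideal_def by blast
  have nb: "\<exists>b\<in>Poly_Mapping.keys m. {u, b} \<in> E" if u: "var u \<in> P" for u
  proof -
    have "y * Poly_Mapping.single (Poly_Mapping.single u 1) 1 \<in> monomial_ideal (edge_power_exponents E 1)"
      using u unfolding y by (simp add: var_def mult.commute)
    then have "m + Poly_Mapping.single u 1 \<in> edge_power_exponents E 1"
      using m(1) unfolding single_mult_in_monomial_ideal_iff by blast
    then obtain a b where ab: "{a, b} \<in> E" "a \<in> Poly_Mapping.keys (m + Poly_Mapping.single u 1)" "b \<in> Poly_Mapping.keys (m + Poly_Mapping.single u 1)"
      unfolding edge_exponents_iff[OF simple] by blast
    have "a \<noteq> b" using ab(1) simple by (auto simp: simple_graph_def)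
    moreover have "\<not> (a \<in> Poly_Mapping.keys m \<and> b \<in> Poly_Mapping.keys m)"
      using m(2) ab(1) unfolding edge_exponents_iff[OF simple] by blast
    moreover have "a \<in> insert u (Poly_Mapping.keys m)" "b \<in> insert u (Poly_Mapping.keys m)"
      using ab(2,3) by (auto simp: in_keys_iff lookup_add lookup_single when_def split: if_splits)
    ultimately show ?thesis using ab(1) by (metis insertE insert_commute)
  qed
  have "vertex_cover E {v. var v \<in> P}"
    unfolding vertex_cover_def
  proof
    fix e assume e: "e \<in> E"
    then obtain u v where uv: "e = {u, v}" using simple by (auto simp: simple_graph_def card_2_iff)
    have "0 + (Poly_Mapping.single u 1 + Poly_Mapping.single v 1) \<in> edge_power_exponents E 1"
      using e uv by (intro edge_power_exponents_single_edge) simp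
    then have "var u * var v \<in> (monomial_ideal (edge_power_exponents E 1) :: ('v, 'k) mpolynomial set)"
      by (simp add: var_def mult_single single_in_monomial_ideal_iff del: edge_power_exponents.simps)
    then have "y * (var u * var v) \<in> monomial_ideal (edge_power_exponents E 1)"
      by (rule ideal_type_algebraD(3)[OF ideal_edge_power])
    then have "var u * var v \<in> P" unfolding y by (simp add: mult.commute)
    then show "e \<inter> {v. var v \<in> P} \<noteq> {}" using primeideal_type_algebraD(3)[OF P] uv by auto
  qed
  moreover have "\<exists>v. v \<notin> {v. var v \<in> P} \<and> {u, v} \<in> E" if u: "u \<in> {v. var v \<in> P}" for u
  proof -
    obtain b where b: "b \<in> Poly_Mapping.keys m" "{u, b} \<in> E" using nb[of u] u by blast
    moreover have "var b \<notin> P"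
    proof
      assume "var b \<in> P"
      then obtain b' where "b' \<in> Poly_Mapping.keys m" "{b, b'} \<in> E" using nb by blast
      with b(1) m(2) show False unfolding edge_exponents_iff[OF simple] by blast
    qed
    ultimately show ?thesis by blast
  qed
  ultimately show ?thesis by (simp add: irredundant_cover_def)
qed

text \<open>The prime is the annihilator of the class of the product of all variables outside \<open>A\<close>: these
  vertices contain no edge because \<open>A\<close> is a cover, and adding any vertex of \<open>A\<close> creates one.\<close>

lemma irredundant_cover_associated_prime:
  fixes E :: "'v::finite set set"
  assumes simple: "simple_graph E" and A: "irredundant_cover E A"
  shows "(monomial_ideal {m. deg_on A m \<noteq> 0} :: ('v, 'k::field) mpolynomial set)
    \<in> associated_primes mpoly_ring (quotient_module mpoly_ring (carrier mpoly_ring) (edge_ideal E))"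
proof -
  define n :: "'v \<Rightarrow>\<^sub>0 nat" where "n = (\<Sum>v\<in>-A. Poly_Mapping.single v 1)"
  have keys: "Poly_Mapping.keys (m + n) = Poly_Mapping.keys m \<union> - A" for m
    unfolding n_def by (auto simp: in_keys_iff lookup_add lookup_sum_single split: if_splits)
  have "m + n \<in> edge_power_exponents E 1 \<longleftrightarrow> deg_on A m \<noteq> 0" for m
  proof
    assume "m + n \<in> edge_power_exponents E 1"
    then obtain u v where uv: "{u, v} \<in> E" "u \<in> Poly_Mapping.keys m \<union> - A" "v \<in> Poly_Mapping.keys m \<union> - A"
      unfolding edge_exponents_iff[OF simple] keys by blast
    moreover have "{u, v} \<inter> A \<noteq> {}" using A uv(1) unfolding irredundant_cover_def vertex_cover_def by blast
    ultimately show "deg_on A m \<noteq> 0" unfolding deg_on_eq_0_iff by blast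
  next
    assume "deg_on A m \<noteq> 0"
    then obtain u where u: "u \<in> Poly_Mapping.keys m" "u \<in> A" unfolding deg_on_eq_0_iff by blast
    then obtain v where "v \<notin> A" "{u, v} \<in> E" using A unfolding irredundant_cover_def by blast
    with u show "m + n \<in> edge_power_exponents E 1" unfolding edge_exponents_iff[OF simple] keys by blast
  qed
  then have "monomial_ideal {m. deg_on A m \<noteq> 0}
    = {r :: ('v, 'k) mpolynomial. r * Poly_Mapping.single n 1 \<in> monomial_ideal (edge_power_exponents E 1)}"
    unfolding single_mult_in_monomial_ideal_iff by (auto simp: monomial_ideal_def)
  then show ?thesis unfolding associated_primes_edge_ideal using primeideal_vars[of A] by blast
qed

text \<open>Every cover contains an irredundant one. Multiplying \<open>f\<close> into \<open>I^t\<close> by an element outside the prime of an irredundant cover \<open>B\<close> cannot raise the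
  least degree of \<open>f\<close> on \<open>B\<close>, which must therefore have been at least \<open>t\<close> before. In the other direction, the product
  of the \<open>t\<close>-th powers of the variables outside the cover serves as multiplier for every \<open>f\<close>.\<close>

lemma symbolic_power_edge_ideal:
  fixes E :: "'v::finite set set"
  assumes simple: "simple_graph E"
  shows "symbolic_power mpoly_ring (edge_ideal E) t
    = (monomial_ideal {m. \<forall>A. vertex_cover E A \<longrightarrow> t \<le> deg_on A m} :: ('v, 'k::field) mpolynomial set)"
proof -
  let ?Ass = "associated_primes mpoly_ring (quotient_module mpoly_ring (carrier mpoly_ring) (edge_ideal E :: ('v, 'k) mpolynomial set))"
  let ?J = "monomial_ideal (edge_power_exponents E t) :: ('v, 'k) mpolynomial set"
  interpret R: cring "mpoly_ring :: ('v, 'k) mpolynomial ring" by (rule cring_from_type_algebra)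
  have contr: "f \<in> loc_contraction mpoly_ring P (loc_extension mpoly_ring P ?J) \<longleftrightarrow> (\<exists>s. s \<notin> P \<and> s * f \<in> ?J)"
    if "P \<in> ?Ass" for P and f :: "('v, 'k) mpolynomial"
    using R.mem_contraction_of_extension_iff[of P ?J f] that ideal_type_algebraD(3)[OF ideal_edge_power]
    unfolding associated_primes_edge_ideal by auto
  show ?thesis
  proof (intro subset_antisym subsetI)
    fix f :: "('v, 'k) mpolynomial" assume f: "f \<in> symbolic_power mpoly_ring (edge_ideal E) t"
    have "t \<le> deg_on A m" if m: "m \<in> Poly_Mapping.keys f" and A: "vertex_cover E A" for m A
    proof (rule ccontr)
      assume less: "\<not> t \<le> deg_on A m"
      obtain B where B: "B \<subseteq> A" "irredundant_cover E B" using irredundant_subcover[OF simple A] by blast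
      let ?P = "monomial_ideal {m. deg_on B m \<noteq> 0} :: ('v, 'k) mpolynomial set"
      have P: "?P \<in> ?Ass" by (rule irredundant_cover_associated_prime[OF simple B(2)])
      from f have "f \<in> (\<Inter>P\<in>?Ass. loc_contraction mpoly_ring P (loc_extension mpoly_ring P ?J))"
        unfolding symbolic_power_def ideal_power_edge_ideal by (rule IntD2)
      then have "f \<in> loc_contraction mpoly_ring ?P (loc_extension mpoly_ring ?P ?J)" using P by (rule INT_D)
      then obtain s where s: "s \<notin> ?P" "s * f \<in> ?J" unfolding contr[OF P] by (elim exE conjE)
      have "\<exists>m\<in>Poly_Mapping.keys s. deg_on B m \<le> 0" using s(1) by (auto simp: monomial_ideal_def)
      moreover have "\<exists>m'\<in>Poly_Mapping.keys f. deg_on B m' \<le> deg_on A m"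
        using m B(1) by (intro bexI[of _ m]) (auto simp: deg_on_def intro: sum_mono2)
      ultimately obtain m' where "m' \<in> Poly_Mapping.keys (s * f)" "deg_on B m' < t"
        using low_degree_exponent_of_product[of s B 0 f "deg_on A m"] less by auto
      then show False
        using s(2) deg_on_cover_edge_power[of E B m' t] B(2) by (auto simp: monomial_ideal_def irredundant_cover_def)
    qed
    then show "f \<in> monomial_ideal {m. \<forall>A. vertex_cover E A \<longrightarrow> t \<le> deg_on A m}" by (auto simp: monomial_ideal_def)
  next
    fix f :: "('v, 'k) mpolynomial" assume f: "f \<in> monomial_ideal {m. \<forall>A. vertex_cover E A \<longrightarrow> t \<le> deg_on A m}"
    have "\<exists>s. s \<notin> P \<and> s * f \<in> ?J" if P: "P \<in> ?Ass" for P
    proof -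
      define A where "A = {v. (var v :: ('v, 'k) mpolynomial) \<in> P}"
      have A: "irredundant_cover E A" unfolding A_def by (rule associated_prime_irredundant_cover[OF simple P])
      let ?n = "\<Sum>v\<in>-A. Poly_Mapping.single v t"
      have "(Poly_Mapping.single ?n 1 :: ('v, 'k) mpolynomial) \<notin> P"
        by (rule monomial_notin_prime) (use P in \<open>auto simp: associated_primes_def A_def\<close>)
      moreover have "f * Poly_Mapping.single ?n 1 \<in> ?J"
        unfolding single_mult_in_monomial_ideal_iff
      proof
        fix m assume "m \<in> Poly_Mapping.keys f"
        then have "t \<le> deg_on A m" using f A by (auto simp: monomial_ideal_def irredundant_cover_def)
        then show "m + ?n \<in> edge_power_exponents E t"
          using A by (intro irredundant_cover_power) (auto simp: irredundant_cover_def)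
      qed
      ultimately show ?thesis by (metis mult.commute)
    qed
    then have "f \<in> loc_contraction mpoly_ring P (loc_extension mpoly_ring P ?J)" if "P \<in> ?Ass" for P
      unfolding contr[OF that] using that .
    then show "f \<in> symbolic_power mpoly_ring (edge_ideal E) t"
      unfolding symbolic_power_def ideal_power_edge_ideal by (intro IntI INT_I) simp_all
  qed
qed

section \<open>The annihilator and its dimension\<close>

text \<open>Adjoin the variables of \<open>F\<close> one at a time to the prime generated by the variables outside \<open>F\<close>.\<close>

lemma chain_of_variable_primes:
  fixes F :: "'v::finite set"
  shows "\<exists>P :: nat \<Rightarrow> ('v, 'k::field) mpolynomial set. (\<forall>i\<le>card F. primeideal (P i) mpoly_ring) \<and>
    (\<forall>i<card F. P i \<subset> P (Suc i)) \<and> P 0 = monomial_ideal {m. deg_on (- F) m \<noteq> 0}"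
proof -
  obtain h where h: "bij_betw h {0..<card F} F" using ex_bij_betw_nat_finite[of F] by auto
  define U where "U i = - F \<union> h ` {..<i}" for i
  define P where "P i = (monomial_ideal {m. deg_on (U i) m \<noteq> 0} :: ('v, 'k) mpolynomial set)" for i
  have "P i \<subset> P (Suc i)" if i: "i < card F" for i
  proof
    have "U i \<subseteq> U (Suc i)" by (auto simp: U_def)
    then show "P i \<subseteq> P (Suc i)" unfolding P_def monomial_ideal_def deg_on_eq_0_iff by blast
    have "h i \<in> U (Suc i)" by (simp add: U_def)
    moreover have "h i \<notin> U i"
      using h i unfolding U_def bij_betw_def inj_on_def by fastforce
    ultimately have "var (h i) \<in> P (Suc i)" "var (h i) \<notin> P i"
      by (auto simp: P_def var_def single_in_monomial_ideal_iff deg_on_single)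
    then show "P i \<noteq> P (Suc i)" by metis
  qed
  moreover have "P 0 = monomial_ideal {m. deg_on (- F) m \<noteq> 0}" by (simp add: P_def U_def)
  moreover have "primeideal (P i) mpoly_ring" for i unfolding P_def by (rule primeideal_vars)
  ultimately show ?thesis by blast
qed

lemma cycle_vertex_has_cycle_neighbour:
  assumes "graph_cycle E c" and "u \<in> set c"
  shows "\<exists>w\<in>set c. {u, w} \<in> E"
proof -
  obtain i where i: "i < length c" "c ! i = u" using assms(2) by (auto simp: in_set_conv_nth)
  then have "{u, c ! (Suc i mod length c)} \<in> E" using assms(1) by (auto simp: graph_cycle_def cycle_edges_def)
  moreover have "Suc i mod length c < length c" using i by (intro mod_less_divisor) linarith
  ultimately show ?thesis by auto
qed

lemma dim_symbolic_quotient: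
  fixes E :: "'v::finite set set"
    and I :: "('v, 'k::field) mpolynomial set"
  assumes simple: "simple_graph E" and uni: "unicyclic E"
    and c: "graph_cycle E c" and len: "length c = 2 * s + 1"
    and I: "I = edge_ideal E" and t: "t \<ge> s + 1"
  defines "W \<equiv> UNIV - closed_nbhd E (set c)"
  shows "module_dim mpoly_ring (quotient_module mpoly_ring
             (symbolic_power mpoly_ring I t) (ideal_power mpoly_ring I t))
         = ereal (real (independence_number W (induced_edges E W)))"
proof -
  interpret R: cring "mpoly_ring :: ('v, 'k) mpolynomial ring" by (rule cring_from_type_algebra)
  let ?Sym = "symbolic_power mpoly_ring I t" and ?Pow = "ideal_power mpoly_ring I t"
  let ?\<alpha> = "independence_number W (induced_edges E W)"
  have Pow: "?Pow = monomial_ideal (edge_power_exponents E t)" by (simp add: I ideal_power_edge_ideal)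
  have idealPow: "ideal ?Pow mpoly_ring" unfolding Pow by (rule ideal_edge_power)
  have Sym: "?Sym = monomial_ideal {m. \<forall>A. vertex_cover E A \<longrightarrow> t \<le> deg_on A m}"
    unfolding I by (rule symbolic_power_edge_ideal[OF simple])
  define J where "J = {r. \<forall>f\<in>?Sym. r * f \<in> ?Pow}"
  have "annihilator mpoly_ring (quotient_module mpoly_ring ?Sym ?Pow) = J"
    using R.annihilator_quotient_module[OF idealPow, of ?Sym] by (simp add: J_def)
  then have dim: "module_dim mpoly_ring (quotient_module mpoly_ring ?Sym ?Pow) = krull_dim (mpoly_ring Quot J)"
    by (simp add: module_dim_def)
  have idealJ: "ideal J mpoly_ring"
  proof (rule ideal_type_algebraI)
    note idealD = ideal_type_algebraD[OF idealPow]
    show "0 \<in> J" using idealD(1) by (simp add: J_def)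
    show "x + y \<in> J" if "x \<in> J" "y \<in> J" for x y
      using that idealD(2) by (simp add: J_def distrib_right)
    show "r * x \<in> J" if "x \<in> J" for x r
      using that idealD(3) by (simp add: J_def mult.assoc)
  qed
  have monomial_in_J: "Poly_Mapping.single n 1 \<in> J"
    if up: "\<And>m. (\<And>A. vertex_cover E A \<Longrightarrow> t \<le> deg_on A m) \<Longrightarrow> m + n \<in> edge_power_exponents E t" for n
  proof -
    have "f * Poly_Mapping.single n 1 \<in> ?Pow" if f: "f \<in> ?Sym" for f
      unfolding Pow single_mult_in_monomial_ideal_iff
    proof
      fix m assume "m \<in> Poly_Mapping.keys f"
      then have "\<And>A. vertex_cover E A \<Longrightarrow> t \<le> deg_on A m" using f unfolding Sym monomial_ideal_def by blast
      then show "m + n \<in> edge_power_exponents E t" by (rule up)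
    qed
    then show ?thesis by (simp add: J_def mult.commute)
  qed
  have ind_sets: "finite (card ` {A. A \<subseteq> W \<and> (\<forall>a\<in>A. \<forall>b\<in>A. {a, b} \<notin> induced_edges E W)})" by simp

  have upper: "n \<le> ?\<alpha>"
    if prime: "\<And>i. i \<le> n \<Longrightarrow> primeideal (P i) mpoly_ring" and chain: "\<And>i. i < n \<Longrightarrow> P i \<subset> P (Suc i)"
      and JP: "J \<subseteq> P 0" for n and P :: "nat \<Rightarrow> ('v, 'k) mpolynomial set"
  proof -
    define F where "F = {v. (var v :: ('v, 'k) mpolynomial) \<notin> P 0}"
    have P0: "primeideal (P 0) mpoly_ring" using prime by simp
    have "u \<notin> F" if u: "u \<in> closed_nbhd E (set c)" for u
    proof -
      have "\<exists>w\<in>set c. {u, w} \<in> E"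
      proof (cases "u \<in> set c")
        case True
        then show ?thesis by (rule cycle_vertex_has_cycle_neighbour[OF c])
      next
        case False
        then show ?thesis using u by (auto simp: closed_nbhd_def nbhd_def insert_commute)
      qed
      then obtain w where w: "w \<in> set c" "{u, w} \<in> E" by blast
      have "Poly_Mapping.single (Poly_Mapping.single u t) 1 \<in> J"
        by (rule monomial_in_J) (rule power_near_cycle[OF simple uni c w])
      then have "var u ^ t \<in> P 0" using JP unfolding var_power by blast
      then show ?thesis using primeideal_type_algebra_power[OF P0] by (auto simp: F_def)
    qed
    then have "F \<subseteq> W" unfolding W_def by blast
    moreover have "{u, v} \<notin> E" if uv: "u \<in> F" "v \<in> F" for u v
    proof
      assume e: "{u, v} \<in> E"
      have "Poly_Mapping.single (Poly_Mapping.single u t + Poly_Mapping.single v t) 1 \<in> J"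
        by (rule monomial_in_J) (rule edge_power_exponents_single_edge[OF e])
      then have "var u ^ t * var v ^ t \<in> P 0" using JP by (auto simp: var_power mult_single)
      then show False
        using primeideal_type_algebraD(3)[OF P0] primeideal_type_algebra_power[OF P0] uv
        unfolding F_def by blast
    qed
    ultimately have "card F \<le> ?\<alpha>"
      unfolding independence_number_def by (intro Max_ge[OF ind_sets] imageI) (auto simp: induced_edges_def)
    moreover have "n \<le> card F" unfolding F_def by (rule prime_chain_length_le[where P = P and n = n, OF prime chain])
    ultimately show ?thesis by simp
  qed

  have lower: "\<exists>P. (\<forall>i\<le>?\<alpha>. primeideal (P i) mpoly_ring) \<and> (\<forall>i<?\<alpha>. P i \<subset> P (Suc i)) \<and> J \<subseteq> P 0"
  proof -
    have "{} \<in> {A. A \<subseteq> W \<and> (\<forall>a\<in>A. \<forall>b\<in>A. {a, b} \<notin> induced_edges E W)}" by simp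
    then have "?\<alpha> \<in> card ` {A. A \<subseteq> W \<and> (\<forall>a\<in>A. \<forall>b\<in>A. {a, b} \<notin> induced_edges E W)}"
      unfolding independence_number_def by (intro Max_in[OF ind_sets]) blast
    then obtain F where F: "F \<subseteq> W" "?\<alpha> = card F"
      and indep: "\<forall>a\<in>F. \<forall>b\<in>F. {a, b} \<notin> induced_edges E W" by blast
    have edge_free: "{a, b} \<notin> E" if "a \<in> F" "b \<in> F" for a b
      using indep that F(1) by (auto simp: induced_edges_def)
    have "c ! 0 \<in> set c" using len by (intro nth_mem) simp
    then obtain u v where uv: "u \<in> set c" "v \<in> set c" "{u, v} \<in> E"
      using cycle_vertex_has_cycle_neighbour[OF c] by metis
    \<comment> \<open>\<open>x\<close> has degree \<open>2 * t - 1\<close>, one less than a product of \<open>t\<close> edges, but weight at least \<open>t\<close> on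
      every vertex cover.\<close>
    define k where "k = t - (s + 1)"
    define x where "x = (\<Sum>w\<in>set c. Poly_Mapping.single w 1) + (Poly_Mapping.single u k + Poly_Mapping.single v k)"
    have "t \<le> deg_on A x" if A: "vertex_cover E A" for A
    proof -
      have "{u, v} \<inter> A \<noteq> {}" using A uv(3) unfolding vertex_cover_def by blast
      then have "k \<le> deg_on A (Poly_Mapping.single u k + Poly_Mapping.single v k)"
        by (auto simp: deg_on_add deg_on_single)
      with card_cover_odd_cycle[OF c len A] t show ?thesis
        unfolding x_def by (simp add: deg_on_add[of A "sum _ _"] deg_on_sum_single k_def)
    qed
    then have xSym: "Poly_Mapping.single x 1 \<in> ?Sym" unfolding Sym by (simp add: single_in_monomial_ideal_iff)
    have "card (set c) = 2 * s + 1" using c len distinct_card[of c] by (simp add: graph_cycle_def)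
    then have deg_x: "deg_on (set c) x = 2 * s + 1 + 2 * k"
      using uv by (simp add: x_def deg_on_add deg_on_sum_single deg_on_single)
    have keys_x: "Poly_Mapping.keys x \<subseteq> set c"
      using uv by (auto simp: x_def in_keys_iff lookup_add lookup_sum_single lookup_single when_def split: if_splits)
    have disj: "F \<inter> set c = {}" using F(1) by (auto simp: W_def closed_nbhd_def)
    have inside: "e \<subseteq> set c" if e: "e \<in> E" "e \<subseteq> F \<union> set c" for e
    proof -
      obtain a b where ab: "e = {a, b}" using simple e(1) by (auto simp: simple_graph_def card_2_iff)
      have cross: "{p, q} \<notin> E" if "p \<in> F" "q \<in> set c" for p q
        using that F(1) by (auto simp: W_def closed_nbhd_def nbhd_def insert_commute)
      show ?thesis using e edge_free[of a b] cross[of a b] cross[of b a] unfolding ab by (auto simp: insert_commute)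
    qed
    have "J \<subseteq> monomial_ideal {m. deg_on (- F) m \<noteq> 0}"
    proof
      fix r assume "r \<in> J"
      then have r: "r * Poly_Mapping.single x 1 \<in> monomial_ideal (edge_power_exponents E t)"
        using xSym unfolding J_def Pow by blast
      have "deg_on (- F) m \<noteq> 0" if m: "m \<in> Poly_Mapping.keys r" for m
      proof
        assume "deg_on (- F) m = 0"
        then have mF: "Poly_Mapping.keys m \<subseteq> F" by (auto simp: deg_on_eq_0_iff)
        then have "Poly_Mapping.keys (m + x) \<subseteq> F \<union> set c"
          using keys_x Poly_Mapping.keys_add[of m x] by blast
        moreover have "m + x \<in> edge_power_exponents E t"
          using r m unfolding single_mult_in_monomial_ideal_iff by blast
        ultimately have "2 * t \<le> deg_on (set c) (m + x)" using deg_on_of_edge_power[of E F "set c"] inside by blast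
        moreover have "deg_on (set c) m = 0" unfolding deg_on_eq_0_iff using mF disj by blast
        ultimately show False using deg_x t by (simp add: deg_on_add k_def)
      qed
      then show "r \<in> monomial_ideal {m. deg_on (- F) m \<noteq> 0}" by (auto simp: monomial_ideal_def)
    qed
    then show ?thesis using chain_of_variable_primes[of F] unfolding F(2) by metis
  qed

  have "krull_dim (mpoly_ring Quot J) = ereal (real ?\<alpha>)"
    unfolding R.krull_dim_quotient[OF idealJ]
  proof (rule Sup_eqI)
    fix y :: ereal
    assume "y \<in> insert (- 1) {ereal (real n) |n. \<exists>P. (\<forall>i\<le>n. primeideal (P i) mpoly_ring) \<and> (\<forall>i<n. P i \<subset> P (Suc i)) \<and> J \<subseteq> P 0}"
    then consider "y = - 1" | n P where "y = ereal (real n)" "\<And>i. i \<le> n \<Longrightarrow> primeideal (P i) mpoly_ring"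
        "\<And>i. i < n \<Longrightarrow> P i \<subset> P (Suc i)" "J \<subseteq> P 0" by blast
    then show "y \<le> ereal (real ?\<alpha>)"
    proof cases
      case 1
      have "(- 1 :: ereal) \<le> 0" by simp
      also have "\<dots> \<le> ereal (real ?\<alpha>)" by simp
      finally show ?thesis using 1 by simp
    next
      case 2
      have "n \<le> ?\<alpha>" by (rule upper[of n P, OF 2(2) 2(3) 2(4)])
      then show ?thesis using 2(1) by simp
    qed
  next
    fix y :: ereal
    assume "\<And>z. z \<in> insert (- 1) {ereal (real n) |n. \<exists>P. (\<forall>i\<le>n. primeideal (P i) mpoly_ring) \<and> (\<forall>i<n. P i \<subset> P (Suc i)) \<and> J \<subseteq> P 0} \<Longrightarrow> z \<le> y"
    then show "ereal (real ?\<alpha>) \<le> y" using lower by blast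
  qed
  with dim show ?thesis by simp
qed

theorem theorem7p10:
  fixes E :: "'v::finite set set"
    and I :: "('v, 'k::field) mpolynomial set"
    and c :: "'v list"
    and s t :: nat
  assumes "simple_graph E" and "connected_graph E" and "unicyclic E"
    and "graph_cycle E c" and "length c = 2 * s + 1" and "s \<ge> 1"
    and "I = edge_ideal E"
    and "t \<ge> s + 1"
  shows "module_dim mpoly_ring (quotient_module mpoly_ring
             (symbolic_power mpoly_ring I t) (ideal_power mpoly_ring I t))
         = module_dim mpoly_ring (quotient_module mpoly_ring
             (symbolic_power mpoly_ring I (s + 1)) (ideal_power mpoly_ring I (s + 1)))
       \<and> module_dim mpoly_ring (quotient_module mpoly_ring
             (symbolic_power mpoly_ring I (s + 1)) (ideal_power mpoly_ring I (s + 1)))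
         = ereal (real (let W = UNIV - closed_nbhd E (set c)
                        in independence_number W (induced_edges E W)))"
  using dim_symbolic_quotient[OF assms(1,3,4,5,7,8)]
    dim_symbolic_quotient[OF assms(1,3,4,5,7) order.refl]
  by (simp add: Let_def)

end
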